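(* Let $d\ge 2$ be an integer and let $\varphi$ be the Laplace transform of a random variable $Z>0$. (a) For integers $j\ge 0$, $k\ge 1$ and $\theta\in\Theta$, let $N_\theta$ be a non-negative integer valued random variable with PGF $P_\theta(s)=s^j\varphi\{(1-s^k)/\theta\}$ (so $P_\theta\in\wp_\varphi(s)$), and let $\{Y_{\theta,i};\,i\ge 1\}$ be i.i.d. random vectors in $\mathbf{R}^d$ independent of $N_\theta$. Let $\{\theta_n\}\subset\Theta$ with $\theta_n\downarrow 0$ and let $\{k_n\}$ be a sequence of natural numbers such that $\vee\{Y_{\theta_n,1},\dots,Y_{\theta_n,k_n}\}$ converges in distribution to a random vector $V$, which is MID. If the $N_\theta$-maxs $\vee\{Y_{\theta,1},\dots,Y_{\theta,N_\theta}\}$ converge in distribution as $\theta\downarrow 0$ through $\{\theta_n\}$, then the limit law is necessarily $\varphi$-MID. (b) Conversely, every $\varphi$-MID law is, for each member of $\wp_\varphi(s)$ (that is, for each choice of integers $j\ge 0$, $k\ge 1$, with $N_\theta$ having PGF $s^j\varphi\{(1-s^k)/\theta\}$), the limit law of $N_\theta$-maxs of i.i.d. random vectors (independent of $N_\theta$) as $\theta\downarrow 0$.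
   Context: $\Theta\subset(0,\infty)$ is a parameter set having $0$ as a limit point. The Laplace transform of $Z>0$ is $\varphi(v)=E(e^{-vZ})$, $v\ge 0$; conventions: $\varphi(\infty)=0$, $-\log 0=\infty$. PGF means probability generating function. Maxima $\vee$ and inequalities are componentwise. The class $\wp_\varphi(s)=\{P_\theta(s)=s^j\varphi[(1-s^k)/\theta],\ 0<s<1,\ j\ge 0,\ k\ge 1\text{ integers},\ \theta>0\}$ consists of PGFs; $j$ and $k$ stay fixed as $\theta\downarrow 0$. An $N_\theta$-max is the random maximum $\vee\{Y_{\theta,1},\dots,Y_{\theta,N_\theta}\}$ (the empty maximum being $-\infty$); its distribution function is $P_\theta\{H_\theta\}$, where $H_\theta$ is the distribution function of $Y_{\theta,1}$, and its convergence to a limit law with distribution function $F$ on $\mathbf{R}^d$ means $P_\theta\{H_\theta\}\to F$ (at continuity points of $F$). A distribution function $G$ on $\mathbf{R}^d$ (or a random vector with that distribution function) is max-infinitely divisible (MID) if $G^{1/n}$ is a distribution function for every integer $n\ge 1$. For the fixed Laplace transform $\varphi$, a distribution function $F$ on $\mathbf{R}^d$ (and its law) is called $\varphi$-MID if for every $\theta\in\Theta$ there exist a distribution function $H_\theta$ and a PGF $P_\theta$ (of a non-negative integer valued random variable $N_\theta$ independent of the vectors having distribution function $H_\theta$) such that $P_\theta\{H_\theta\}\to F=\varphi\{-\log G\}$ as $\theta\downarrow 0$ through some sequence $\{\theta_n\}\subset\Theta$, where $G$ is a distribution function that is MID. *)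

theory Defs
  imports "HOL-Probability.Probability"
begin

definition laplace_transform :: "'z measure \<Rightarrow> ('z \<Rightarrow> real) \<Rightarrow> real \<Rightarrow> real" where
  "laplace_transform M Z v = (\<integral>\<omega>. exp (- (v * Z \<omega>)) \<partial>M)"

text \<open>The conventions \<open>\<phi>(\<infinity>) = 0\<close> and \<open>- log 0 = \<infinity>\<close>.\<close>

definition at_ereal :: "(real \<Rightarrow> real) \<Rightarrow> ereal \<Rightarrow> real" where
  "at_ereal \<phi> v = (if v = \<infinity> then 0 else \<phi> (real_of_ereal v))"

definition neg_log :: "real \<Rightarrow> ereal" where
  "neg_log u = (if u = 0 then \<infinity> else ereal (- ln u))"

text \<open>The order on \<^typ>\<open>real ^ 'n\<close> is componentwise, so \<open>{..x}\<close> is the lower orthant at \<open>x\<close>.\<close>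

definition dist_fun :: "(real ^ 'n) measure \<Rightarrow> real ^ 'n \<Rightarrow> real" where
  "dist_fun \<mu> x = measure \<mu> {..x}"

definition is_dist_fun :: "(real ^ 'n \<Rightarrow> real) \<Rightarrow> bool" where
  "is_dist_fun F \<longleftrightarrow> (\<exists>\<mu>. prob_space \<mu> \<and> sets \<mu> = sets borel \<and> F = dist_fun \<mu>)"

definition MID :: "(real ^ 'n \<Rightarrow> real) \<Rightarrow> bool" where
  "MID G \<longleftrightarrow> is_dist_fun G \<and> (\<forall>n::nat. n \<ge> 1 \<longrightarrow> is_dist_fun (\<lambda>x. G x powr (1 / real n)))"

definition dist_fun_tendsto ::
  "('i \<Rightarrow> real ^ 'n \<Rightarrow> real) \<Rightarrow> (real ^ 'n \<Rightarrow> real) \<Rightarrow> 'i filter \<Rightarrow> bool" where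
  "dist_fun_tendsto Fs F net \<longleftrightarrow> (\<forall>x. isCont F x \<longrightarrow> ((\<lambda>i. Fs i x) \<longlongrightarrow> F x) net)"

definition is_pgf :: "(real \<Rightarrow> real) \<Rightarrow> bool" where
  "is_pgf P \<longleftrightarrow> (\<exists>p :: nat pmf. \<forall>s\<in>{0..1}. P s = measure_pmf.expectation p (\<lambda>n. s ^ n))"

definition has_pgf :: "'a measure \<Rightarrow> ('a \<Rightarrow> nat) \<Rightarrow> (real \<Rightarrow> real) \<Rightarrow> bool" where
  "has_pgf M N P \<longleftrightarrow> (\<forall>s. 0 < s \<and> s < 1 \<longrightarrow> (\<integral>\<omega>. s ^ N \<omega> \<partial>M) = P s)"

definition phi_pgf :: "(real \<Rightarrow> real) \<Rightarrow> nat \<Rightarrow> nat \<Rightarrow> real \<Rightarrow> real \<Rightarrow> real" where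
  "phi_pgf \<phi> j k \<theta> s = s ^ j * \<phi> ((1 - s ^ k) / \<theta>)"

definition decreases_to_0 :: "real set \<Rightarrow> (nat \<Rightarrow> real) \<Rightarrow> bool" where
  "decreases_to_0 \<Theta> \<theta>s \<longleftrightarrow> range \<theta>s \<subseteq> \<Theta> \<and> decseq \<theta>s \<and> \<theta>s \<longlonglongrightarrow> 0"

definition phi_MID :: "real set \<Rightarrow> (real \<Rightarrow> real) \<Rightarrow> (real ^ 'n \<Rightarrow> real) \<Rightarrow> bool" where
  "phi_MID \<Theta> \<phi> F \<longleftrightarrow>
    is_dist_fun F \<and>
    (\<exists>H P \<theta>s G.
      (\<forall>\<theta>\<in>\<Theta>. is_dist_fun (H \<theta>) \<and> is_pgf (P \<theta>)) \<and>
      decreases_to_0 \<Theta> \<theta>s \<and>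
      dist_fun_tendsto (\<lambda>n x. P (\<theta>s n) (H (\<theta>s n) x)) F sequentially \<and>
      MID G \<and>
      F = (\<lambda>x. at_ereal \<phi> (neg_log (G x))))"

text \<open>In \<^typ>\<open>ereal\<close> the supremum of the empty set is \<open>-\<infinity>\<close>, the value of the empty maximum.\<close>

definition rand_max :: "('a \<Rightarrow> nat) \<Rightarrow> (nat \<Rightarrow> 'a \<Rightarrow> real ^ 'n) \<Rightarrow> 'a \<Rightarrow> ereal ^ 'n" where
  "rand_max N Y \<omega> = (\<chi> c. SUP i\<in>{1..N \<omega>}. ereal (Y i \<omega> $ c))"

definition ext_dist_fun :: "'a measure \<Rightarrow> ('a \<Rightarrow> ereal ^ 'n) \<Rightarrow> real ^ 'n \<Rightarrow> real" where
  "ext_dist_fun M X x = measure M {\<omega> \<in> space M. X \<omega> \<le> (\<chi> c. ereal (x $ c))}"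

definition iid_vectors :: "'a measure \<Rightarrow> (nat \<Rightarrow> 'a \<Rightarrow> real ^ 'n) \<Rightarrow> bool" where
  "iid_vectors M Y \<longleftrightarrow>
    prob_space.indep_vars M (\<lambda>_. borel) Y {1..} \<and>
    (\<forall>i\<ge>1. distr M borel (Y i) = distr M borel (Y 1))"

text \<open>
  The library's \<open>indep_var\<close> needs both variables to have the same value type; the following is
  independence of the \<open>\<sigma>\<close>-algebras generated by \<open>N\<close> and by the whole sequence \<open>Y\<close>.
\<close>

definition indep_of_sequence ::
  "'a measure \<Rightarrow> ('a \<Rightarrow> nat) \<Rightarrow> (nat \<Rightarrow> 'a \<Rightarrow> real ^ 'n) \<Rightarrow> bool" where
  "indep_of_sequence M N Y \<longleftrightarrow>
    prob_space.indep_set M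
      {N -` A \<inter> space M | A. A \<in> sets (count_space UNIV)}
      {(\<lambda>\<omega>. \<lambda>i\<in>{1..}. Y i \<omega>) -` B \<inter> space M | B. B \<in> sets (\<Pi>\<^sub>M i\<in>{1..}. borel)}"

definition max_model :: "'a measure \<Rightarrow> ('a \<Rightarrow> nat) \<Rightarrow> (nat \<Rightarrow> 'a \<Rightarrow> real ^ 'n) \<Rightarrow> bool" where
  "max_model M N Y \<longleftrightarrow>
    prob_space M \<and> N \<in> measurable M (count_space UNIV) \<and> iid_vectors M Y \<and> indep_of_sequence M N Y"

end

theory Submission
  imports Defs
begin

text \<open>
  An \<open>N\<^sub>\<theta>\<close>-max has distribution function \<open>P\<^sub>\<theta>(H\<^sub>\<theta>)\<close>, and \<open>g \<mapsto> \<phi>(- log g) = E(g\<^sup>Z)\<close> is an increasing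
  homeomorphism of \<open>[0, 1]\<close>. So if \<open>P\<^sub>\<theta>(H\<^sub>\<theta>) \<rightarrow> F\<close>, then \<open>F = \<phi>(- log G)\<close> for a unique \<open>G\<close>, and
  \<open>(1 - H\<^sub>\<theta>\<^sup>k)/\<theta> \<rightarrow> - log G\<close> shows that \<open>H\<^sub>\<theta>\<close> raised to the integer power \<open>k q\<close> with \<open>q \<approx> 1/(r\<theta>)\<close>
  converges to \<open>G\<close> raised to \<open>1/r\<close>, wherever \<open>F\<close> is continuous. That such a limit of distribution
  functions is again a distribution function follows from weak sequential compactness of the laws on
  the unit cube. Composition with a space-filling curve \<open>h\<close> reduces the latter to Helly's theorem on
  the line: laws on the cube lift to the interval along a measurable section of \<open>h\<close>, and weak limits
  are pushed forward by the continuous map \<open>h\<close>.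

  Conversely, if \<open>F = \<phi>(- log G)\<close> with \<open>G\<close> MID, take for \<open>H\<^sub>\<theta>\<close> the \<open>n\<close>-th root of \<open>G\<close> with
  \<open>n = \<lceil>k/\<theta>\<rceil>\<close>, and \<open>N\<^sub>\<theta> = j + k N\<close> with \<open>N\<close> mixed Poisson of random rate \<open>Z/\<theta>\<close>.
\<close>

section \<open>A space-filling curve and weak compactness on the cube\<close>

text \<open>
  The function behind Schoenberg's space-filling curve: it has period 2 and is constantly 0 on
  \<open>[0, 1/3]\<close> and 1 on \<open>[2/3, 1]\<close>, so \<open>digit_wave (3 ^ k * t)\<close> reads off whether the ternary digit
  number \<open>k\<close> of a point \<open>t\<close> of the Cantor set is 0 or 2.
\<close>

definition digit_wave :: "real \<Rightarrow> real" where
  "digit_wave t = max 0 (min 1 (1/2 - cos (pi * t)))"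

lemma continuous_on_digit_wave: "continuous_on UNIV digit_wave"
  unfolding digit_wave_def by (intro continuous_intros)

lemma digit_wave_bounds: "0 \<le> digit_wave t" "digit_wave t \<le> 1"
  by (auto simp: digit_wave_def)

lemma digit_wave_low:
  assumes "0 \<le> u" "u \<le> 1/3"
  shows "digit_wave (2 * real m + u) = 0"
proof -
  have "cos (pi * (2 * real m + u)) = cos (pi * u + 2 * real m * pi)"
    by (simp add: algebra_simps)
  also have "\<dots> = cos (pi * u)"
    by (simp add: cos_add)
  also have "\<dots> \<ge> cos (pi / 3)"
    using assms by (intro cos_monotone_0_pi_le) (auto simp: field_simps)
  finally show ?thesis by (simp add: digit_wave_def cos_60)
qed

lemma digit_wave_high:
  assumes "2/3 \<le> u" "u \<le> 1"
  shows "digit_wave (2 * real m + u) = 1"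
proof -
  have "cos (pi * (2 * real m + u)) = cos (pi * u + 2 * real m * pi)"
    by (simp add: algebra_simps)
  also have "\<dots> = cos (pi * u)"
    by (simp add: cos_add)
  also have "\<dots> \<le> cos (pi - pi / 3)"
    using assms by (intro cos_monotone_0_pi_le) (auto simp: field_simps)
  also have "\<dots> = - (1/2)"
    by (simp only: cos_pi_minus cos_60)
  finally show ?thesis by (simp add: digit_wave_def)
qed

text \<open>The witness is the Cantor point with ternary digits \<open>2 * a i\<close>.
  Multiplication by \<open>3 ^ k\<close> shifts the digits, and what is split off in front of the
  tail \<open>T k\<close> is an even integer because every digit is even; the period 2 of
  \<open>digit_wave\<close> absorbs it.\<close>

lemma digit_wave_reads_digits:
  fixes a :: "nat \<Rightarrow> nat"
  assumes a: "\<And>i. a i \<le> 1"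
  shows "\<exists>t\<in>{0..1}. \<forall>k. digit_wave (3 ^ k * t) = real (a k)"
proof -
  define T where "T k = (\<Sum>i. 2 * real (a (i + k)) * (1/3) ^ Suc i)" for k
  have geo: "(\<lambda>i. 2 * (1/3::real) ^ Suc i) sums 1"
    using sums_mult[OF geometric_sums[of "1/3::real"], of "2/3"] by simp
  have bd: "2 * real (a (i + k)) * (1/3) ^ Suc i \<le> 2 * (1/3) ^ Suc i" for i k
    using a[of "i + k"] by simp
  have sm: "summable (\<lambda>i. 2 * real (a (i + k)) * (1/3) ^ Suc i)" for k
    by (rule summable_comparison_test'[OF sums_summable[OF geo], of 0]) (use bd[of _ k] in auto)
  have T0: "0 \<le> T k" for k
    unfolding T_def by (intro suminf_nonneg sm) auto
  have T1: "T k \<le> 1" for k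
    using suminf_le[OF bd[of _ k] sm sums_summable[OF geo]] sums_unique[OF geo] by (simp add: T_def)
  have TS: "T k = 2 * real (a k) / 3 + T (Suc k) / 3" for k
  proof -
    have "T k = 2 * real (a k) * (1/3) ^ Suc 0 + (\<Sum>i. 2 * real (a (Suc i + k)) * (1/3) ^ Suc (Suc i))"
      unfolding T_def using suminf_split_head[OF sm[of k]] by simp
    also have "(\<Sum>i. 2 * real (a (Suc i + k)) * (1/3) ^ Suc (Suc i))
        = (\<Sum>i. (1/3) * (2 * real (a (i + Suc k)) * (1/3) ^ Suc i))"
      by (simp add: algebra_simps)
    also have "\<dots> = (1/3) * T (Suc k)"
      unfolding T_def by (rule suminf_mult[OF sm])
    finally show ?thesis by simp
  qed
  have rep: "\<exists>m. 3 ^ k * T 0 = 2 * real m + T k" for k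
  proof (induction k)
    case (Suc k)
    then obtain m where "3 ^ k * T 0 = 2 * real m + T k" by auto
    then have "3 ^ Suc k * T 0 = 2 * real (3 * m + a k) + T (Suc k)"
      using TS[of k] by simp
    then show ?case by blast
  qed (auto intro: exI[of _ 0])
  have "digit_wave (3 ^ k * T 0) = real (a k)" for k
  proof -
    obtain m where m: "3 ^ k * T 0 = 2 * real m + T k" using rep by blast
    consider "a k = 0" | "a k = 1" using a[of k] by linarith
    then show ?thesis
    proof cases
      case 1
      then have "T k \<le> 1/3" using TS[of k] T1[of "Suc k"] by simp
      with m 1 T0 digit_wave_low show ?thesis by simp
    next
      case 2
      then have "2/3 \<le> T k" using TS[of k] T0[of "Suc k"] by simp
      with m 2 T1 digit_wave_high show ?thesis by simp
    qed
  qed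
  with T0 T1 show ?thesis by (intro bexI[of _ "T 0"]) auto
qed

text \<open>The digit \<open>a i\<close> is the parity of
  \<open>\<lfloor>2 ^ Suc i * z\<rfloor>\<close>. The partial sums are
  \<open>\<lfloor>2 ^ m * z\<rfloor> / 2 ^ m\<close>, within \<open>(1/2) ^ m\<close> of
  \<open>z\<close>; the bound \<open>z < 1\<close> starts the induction with
  \<open>\<lfloor>z\<rfloor> = 0\<close>.\<close>

lemma binary_expansion:
  fixes z :: real
  assumes "0 \<le> z" "z < 1"
  shows "\<exists>a::nat \<Rightarrow> nat. (\<forall>i. a i \<le> 1) \<and> (\<lambda>i. real (a i) * (1/2) ^ Suc i) sums z"
proof -
  define a where "a i = nat (\<lfloor>2 ^ Suc i * z\<rfloor> mod 2)" for i
  have fl: "\<lfloor>2 * x\<rfloor> = 2 * \<lfloor>x\<rfloor> + \<lfloor>2 * x\<rfloor> mod 2" for x :: real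
  proof -
    have "\<lfloor>2 * x\<rfloor> div 2 = \<lfloor>x\<rfloor>"
      using floor_divide_real_eq_div[of 2 "2 * x"] by simp
    then show ?thesis by presburger
  qed
  have part: "(\<Sum>i<m. real (a i) * (1/2) ^ Suc i) = of_int \<lfloor>2 ^ m * z\<rfloor> / 2 ^ m" for m
  proof (induction m)
    case 0
    have "\<lfloor>z\<rfloor> = 0" using assms by (simp add: floor_eq_iff)
    then show ?case by simp
  next
    case (Suc m)
    have "real_of_int \<lfloor>2 ^ Suc m * z\<rfloor> = 2 * of_int \<lfloor>2 ^ m * z\<rfloor> + real (a m)"
      using fl[of "2 ^ m * z"] by (simp add: a_def mult.assoc)
    then show ?case using Suc by (simp add: field_simps)
  qed
  have "(\<lambda>m. real_of_int \<lfloor>2 ^ m * z\<rfloor> / 2 ^ m) \<longlonglongrightarrow> z"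
  proof (rule tendsto_sandwich[where f="\<lambda>m. z - (1/2) ^ m" and h="\<lambda>_. z"])
    have "(\<lambda>m. z - (1/2::real) ^ m) \<longlonglongrightarrow> z - 0"
      by (intro tendsto_intros LIMSEQ_power_zero) auto
    then show "(\<lambda>m. z - (1/2::real) ^ m) \<longlonglongrightarrow> z" by simp
    show "\<forall>\<^sub>F m in sequentially. z - (1/2) ^ m \<le> real_of_int \<lfloor>2 ^ m * z\<rfloor> / 2 ^ m"
    proof (intro always_eventually allI)
      fix m
      have "2 ^ m * z - 1 \<le> real_of_int \<lfloor>2 ^ m * z\<rfloor>" by linarith
      then have "(2 ^ m * z - 1) / 2 ^ m \<le> real_of_int \<lfloor>2 ^ m * z\<rfloor> / 2 ^ m"
        by (intro divide_right_mono) auto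
      then show "z - (1/2) ^ m \<le> real_of_int \<lfloor>2 ^ m * z\<rfloor> / 2 ^ m"
        by (simp add: diff_divide_distrib power_divide)
    qed
    show "\<forall>\<^sub>F m in sequentially. real_of_int \<lfloor>2 ^ m * z\<rfloor> / 2 ^ m \<le> z"
    proof (intro always_eventually allI)
      fix m
      have "real_of_int \<lfloor>2 ^ m * z\<rfloor> \<le> 2 ^ m * z" by linarith
      then show "real_of_int \<lfloor>2 ^ m * z\<rfloor> / 2 ^ m \<le> z" by (simp add: field_simps)
    qed
  qed auto
  then have "(\<lambda>i. real (a i) * (1/2) ^ Suc i) sums z"
    unfolding sums_def part .
  moreover have "a i \<le> 1" for i
    unfolding a_def using pos_mod_bound[of 2 "\<lfloor>2 ^ Suc i * z\<rfloor>"] by linarith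
  ultimately show ?thesis by blast
qed

text \<open>One Cantor point stores the binary expansions of all coordinates, interleaved, and
  \<open>digit_wave\<close> recovers each digit. The cube is half-open because the expansions come
  from \<open>binary_expansion\<close>, which covers \<open>0 \<le> z < 1\<close>.\<close>

lemma space_filling_curve:
  "\<exists>h :: real \<Rightarrow> real ^ 'n. continuous_on UNIV h \<and>
     (\<forall>z. (\<forall>c. 0 \<le> z $ c \<and> z $ c < 1) \<longrightarrow> (\<exists>t\<in>{0..1}. h t = z))"
proof -
  define d where "d = CARD('n)"
  have d: "d > 0" by (simp add: d_def)
  obtain idx :: "'n \<Rightarrow> nat" where idx: "bij_betw idx UNIV {..<d}"
    using ex_bij_betw_finite_nat[of "UNIV :: 'n set"] by (auto simp: d_def atLeast0LessThan)
  define e where "e = inv_into UNIV idx"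
  have e: "e (idx c) = c" for c
    using idx by (simp add: e_def bij_betw_def)
  have il: "idx c < d" for c using idx by (auto simp: bij_betw_def)
  \<comment> \<open>The ternary digits whose index is congruent to \<open>idx c\<close> modulo
    \<open>d\<close> become the binary digits of coordinate \<open>c\<close>.\<close>
  define h where "h t = (\<chi> c. \<Sum>m. digit_wave (3 ^ (m * d + idx c) * t) * (1/2) ^ Suc m)" for t
  have geo: "(\<lambda>i. (1/2::real) ^ Suc i) sums 1"
    using sums_mult[OF geometric_sums[of "1/2::real"], of "1/2"] by simp
  have "continuous_on UNIV (\<lambda>t. \<Sum>m. digit_wave (3 ^ (m * d + idx c) * t) * (1/2) ^ Suc m)" for c
  proof (rule uniform_limit_theorem[where F=sequentially])
    show "uniform_limit UNIV (\<lambda>n t. \<Sum>m<n. digit_wave (3 ^ (m * d + idx c) * t) * (1/2) ^ Suc m)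
            (\<lambda>t. \<Sum>m. digit_wave (3 ^ (m * d + idx c) * t) * (1/2) ^ Suc m) sequentially"
      by (rule Weierstrass_m_test[OF _ sums_summable[OF geo]])
         (use digit_wave_bounds in \<open>auto simp: abs_mult\<close>)
    show "\<forall>\<^sub>F n in sequentially. continuous_on UNIV
            (\<lambda>t. \<Sum>m<n. digit_wave (3 ^ (m * d + idx c) * t) * (1/2) ^ Suc m)"
      by (intro always_eventually allI continuous_intros
            continuous_on_compose2[OF continuous_on_digit_wave]) auto
  qed auto
  then have "continuous_on UNIV h"
    unfolding h_def by (intro continuous_on_vec_lambda)
  moreover have "\<exists>t\<in>{0..1}. h t = z" if z: "\<forall>c. 0 \<le> z $ c \<and> z $ c < 1" for z
  proof -
    have "\<forall>c. \<exists>a::nat \<Rightarrow> nat. (\<forall>i. a i \<le> 1) \<and> (\<lambda>i. real (a i) * (1/2) ^ Suc i) sums (z $ c)"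
      using z binary_expansion by blast
    then obtain A :: "'n \<Rightarrow> nat \<Rightarrow> nat" where A: "\<And>c i. A c i \<le> 1"
      "\<And>c. (\<lambda>i. real (A c i) * (1/2) ^ Suc i) sums (z $ c)"
      by metis
    \<comment> \<open>This inverts the interleaving: digit \<open>k\<close> is digit number
      \<open>k div d\<close> of the coordinate with index \<open>k mod d\<close>.\<close>
    obtain t where t: "t \<in> {0..1}" "\<And>k. digit_wave (3 ^ k * t) = real (A (e (k mod d)) (k div d))"
      using digit_wave_reads_digits[of "\<lambda>k. A (e (k mod d)) (k div d)"] A(1) by auto
    have "h t $ c = z $ c" for c
      unfolding h_def using t(2) d il[of c] sums_unique[OF A(2)[of c]] by (simp add: e)
    then have "h t = z" by (simp add: vec_eq_iff)
    with t(1) show ?thesis by blast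
  qed
  ultimately show ?thesis by blast
qed

section \<open>Weak sequential compactness on the cube from Helly's theorem on the line\<close>

text \<open>The laws are lifted to \<open>{0..1}\<close> by a measurable right inverse
  \<open>g\<close> of \<open>h\<close>. For bounded continuous \<open>f\<close> the composition of
  \<open>f\<close> with \<open>h\<close> is bounded and continuous as well, so weak convergence of
  the lifts yields convergence of the integrals of \<open>f\<close>, the limit law being the image
  under \<open>h\<close>.\<close>

lemma weak_compactness_cube:
  fixes \<mu> :: "nat \<Rightarrow> (real ^ 'n) measure"
  assumes prob: "\<And>n. prob_space (\<mu> n)" and sets: "\<And>n. sets (\<mu> n) = sets borel"
    and cube: "\<And>n. AE z in \<mu> n. \<forall>c. 0 \<le> z $ c \<and> z $ c < 1"
  shows "\<exists>r \<nu>. strict_mono (r :: nat \<Rightarrow> nat) \<and> prob_space \<nu> \<and> sets \<nu> = sets borel \<and>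
    (\<forall>(f :: real ^ 'n \<Rightarrow> real) B. continuous_on UNIV f \<longrightarrow> (\<forall>z. \<bar>f z\<bar> \<le> B) \<longrightarrow>
       (\<lambda>n. integral\<^sup>L (\<mu> (r n)) f) \<longlonglongrightarrow> integral\<^sup>L \<nu> f)"
proof -
  obtain h :: "real \<Rightarrow> real ^ 'n" where h: "continuous_on UNIV h"
    "\<And>z. (\<forall>c. 0 \<le> z $ c \<and> z $ c < 1) \<Longrightarrow> \<exists>t\<in>{0..1}. h t = z"
    using space_filling_curve by blast
  have [measurable]: "h \<in> borel_measurable borel"
    by (intro borel_measurable_continuous_onI h)
  have comp: "compact (h ` {0..t})" for t
    by (intro compact_continuous_image continuous_on_subset[OF h(1)]) auto
  \<comment> \<open>\<open>g\<close> picks the first parameter that reaches \<open>z\<close>. The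
    value 0 off the image of \<open>{0..1}\<close> is a default that keeps \<open>g\<close> inside
    \<open>{0..1}\<close>; by \<open>cube\<close> and the choice of \<open>h\<close> those points
    form a null set.\<close>
  define g where "g z = (if z \<in> h ` {0..1} then Inf {t\<in>{0..1}. h t = z} else 0)" for z
  have least: "g z \<in> {0..1} \<and> h (g z) = z \<and> (\<forall>t\<in>{0..1}. h t = z \<longrightarrow> g z \<le> t)" if "z \<in> h ` {0..1}" for z
  proof -
    have "{t\<in>{0..1}. h t = z} = {0..1} \<inter> h -` {z}" by auto
    moreover have "closed (h -` {z})"
      using continuous_closed_vimage[of "{z}" h] h(1) by (simp add: continuous_on_eq_continuous_at)
    ultimately have "closed {t\<in>{0..1}. h t = z}" by (simp add: closed_Int)
    moreover have bb: "bdd_below {t\<in>{0..1}. h t = z}" by (auto intro: bdd_belowI[of _ 0])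
    moreover have "{t\<in>{0..1}. h t = z} \<noteq> {}" using that by auto
    ultimately have "Inf {t\<in>{0..1}. h t = z} \<in> {t\<in>{0..1}. h t = z}"
      by (intro closed_contains_Inf)
    with bb that show ?thesis by (auto simp: g_def intro: cInf_lower)
  qed
  \<comment> \<open>Choosing the first parameter makes the section lower semicontinuous, hence measurable.\<close>
  have [measurable]: "g \<in> borel_measurable borel"
  proof (rule borel_measurableI_le)
    fix y :: real
    \<comment> \<open>For \<open>0 \<le> y < 1\<close> a point of the image satisfies
      \<open>g x \<le> y\<close> iff the curve reaches it by time \<open>y\<close>, which gives a
      compact set; points off the image carry the default 0 and all belong to the sublevel
      set.\<close>
    have "{x. g x \<le> y} = (if y < 0 then {} else if y \<ge> 1 then UNIV else h ` {0..y} \<union> - h ` {0..1})"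
    proof -
      have "0 \<le> g x" "g x \<le> 1" for x
        using least[of x] by (auto simp: g_def[of x] split: if_splits)
      moreover have "g x \<le> y \<longleftrightarrow> x \<in> h ` {0..y} \<union> - h ` {0..1}" if y: "0 \<le> y" "y < 1" for x
      proof (cases "x \<in> h ` {0..1}")
        case True
        have "x \<in> h ` {0..y}" if "g x \<le> y"
          using least[OF True] that by (intro image_eqI[of _ _ "g x"]) auto
        moreover have "g x \<le> y" if "x \<in> h ` {0..y}"
        proof -
          obtain t where "t \<in> {0..y}" "x = h t" using \<open>x \<in> h ` {0..y}\<close> by blast
          with least[OF True] y show ?thesis by force
        qed
        ultimately show ?thesis using True by blast
      next
        case False
        then show ?thesis using y by (simp add: g_def)
      qed
      ultimately show ?thesis by (auto intro: order.trans) (meson not_le order.trans)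
    qed
    also have "\<dots> \<in> sets borel"
      using borel_compact[OF comp] by (auto intro!: sets.Un borel_comp)
    finally show "{x \<in> space borel. g x \<le> y} \<in> sets borel" by simp
  qed
  have g01: "g z \<in> {0..1}" for z
    using least[of z] by (auto simp: g_def[of z])
  have meas: "measurable (\<mu> n) M = measurable borel M" for n and M :: "real measure"
    by (rule measurable_cong_sets[OF sets refl])
  define \<kappa> where "\<kappa> n = distr (\<mu> n) borel g" for n
  have rd: "real_distribution (\<kappa> n)" for n
    unfolding \<kappa>_def using prob[of n]
    by (intro prob_space.real_distribution_distr) (auto simp: meas)
  have "tight \<kappa>"
    unfolding tight_def
  proof (intro conjI allI impI rd)
    fix \<epsilon> :: real assume "\<epsilon> > 0"
    \<comment> \<open>Tightness is expressed with intervals open on the left, so the left end is -1: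
      the point 0 may be an atom of \<open>\<kappa> n\<close>.\<close>
    have "measure (\<kappa> n) {-1<..1} = 1" for n
    proof -
      interpret prob_space "\<mu> n" by fact
      have "g -` {-1<..1} = UNIV" using g01 by (force intro: less_le_trans[of _ 0])
      moreover have "g \<in> borel_measurable (\<mu> n)" by (simp add: meas)
      ultimately show ?thesis
        using prob_space by (simp add: \<kappa>_def measure_distr)
    qed
    with \<open>\<epsilon> > 0\<close> show "\<exists>a b. a < b \<and> (\<forall>n. 1 - \<epsilon> < measure (\<kappa> n) {a<..b})"
      by (intro exI[of _ "-1"] exI[of _ 1]) auto
  qed
  then obtain r K where r: "strict_mono r" "real_distribution K" "weak_conv_m (\<kappa> \<circ> r) K"
    using tight_imp_convergent_subsubsequence[of \<kappa> id] by (auto simp: strict_mono_id)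
  interpret K: real_distribution K by fact
  define \<nu> where "\<nu> = distr K borel h"
  have mh: "h \<in> borel_measurable K" by (simp add: measurable_cong_sets[OF K.events_eq_borel refl])
  have "(\<lambda>n. integral\<^sup>L (\<mu> (r n)) f) \<longlonglongrightarrow> integral\<^sup>L \<nu> f"
    if f: "continuous_on UNIV f" "\<And>z. \<bar>f z\<bar> \<le> B" for f :: "real ^ 'n \<Rightarrow> real" and B
  proof -
    have [measurable]: "f \<in> borel_measurable borel"
      by (intro borel_measurable_continuous_onI f)
    have fh: "continuous_on UNIV (\<lambda>t. f (h t))"
      by (rule continuous_on_compose2[OF f(1) h(1)]) auto
    have "(\<lambda>n. integral\<^sup>L ((\<kappa> \<circ> r) n) (\<lambda>t. f (h t))) \<longlonglongrightarrow> integral\<^sup>L K (\<lambda>t. f (h t))"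
      using r(2,3) fh f(2)
      by (intro weak_conv_imp_integral_bdd_continuous_conv[where B=B])
         (auto simp: continuous_on_eq_continuous_at rd simp del: o_apply, simp add: rd)
    moreover have "integral\<^sup>L K (\<lambda>t. f (h t)) = integral\<^sup>L \<nu> f"
      unfolding \<nu>_def using mh by (subst integral_distr) auto
    moreover have "integral\<^sup>L ((\<kappa> \<circ> r) n) (\<lambda>t. f (h t)) = integral\<^sup>L (\<mu> (r n)) f" for n
    proof -
      have "integral\<^sup>L (\<kappa> (r n)) (\<lambda>t. f (h t)) = (\<integral>z. f (h (g z)) \<partial>\<mu> (r n))"
        unfolding \<kappa>_def by (subst integral_distr) (auto simp: meas)
      also have "\<dots> = integral\<^sup>L (\<mu> (r n)) f"
      proof (rule integral_cong_AE)
        show "AE z in \<mu> (r n). f (h (g z)) = f z"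
          using cube[of "r n"]
        proof eventually_elim
          case (elim z)
          then have "z \<in> h ` {0..1}" using h(2)[of z] by blast
          then show ?case using least by simp
        qed
      qed (auto simp: meas)
      finally show ?thesis by simp
    qed
    ultimately show ?thesis by simp
  qed
  moreover have "prob_space \<nu>" "sets \<nu> = sets borel"
    using K.prob_space_distr[OF mh] by (simp_all add: \<nu>_def)
  ultimately show ?thesis using r(1) by blast
qed

section \<open>Limits of distribution functions\<close>

text \<open>The diagonal line through \<open>x\<close>. For a monotone function the behaviour along
  it decides continuity and continuity from above, which reduces both to one real variable.\<close>

definition shift_all :: "real ^ 'n \<Rightarrow> real \<Rightarrow> real ^ 'n" where
  "shift_all x t = (\<chi> c. x $ c + t)"

definition replace_coord :: "real ^ 'n \<Rightarrow> 'n \<Rightarrow> real \<Rightarrow> real ^ 'n" where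
  "replace_coord x c t = (\<chi> i. if i = c then t else x $ i)"

text \<open>
  The properties of a distribution function other than non-negativity of the rectangle increments;
  the latter are inherited from the approximating functions in \<open>dist_fun_limit\<close>.
\<close>

definition df_like :: "(real ^ 'n \<Rightarrow> real) \<Rightarrow> bool" where
  "df_like F \<longleftrightarrow> mono F \<and>
     (\<forall>x. ((\<lambda>t. F (shift_all x t)) \<longlongrightarrow> F x) (at_right 0)) \<and>
     ((\<lambda>t. F (shift_all 0 t)) \<longlongrightarrow> 1) at_top \<and>
     (\<forall>x c. ((\<lambda>t. F (replace_coord x c t)) \<longlongrightarrow> 0) at_bot)"

lemma borel_measurable_vec_lambda:
  fixes f :: "'a \<Rightarrow> 'n::finite \<Rightarrow> real"
  assumes "\<And>c. (\<lambda>x. f x c) \<in> borel_measurable M"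
  shows "(\<lambda>x. \<chi> c. f x c) \<in> borel_measurable M"
  using assms
  by (subst borel_measurable_euclidean_space) (auto simp: Basis_vec_def inner_axis)

lemma borel_measurable_vec_nth_comp [measurable (raw)]:
  fixes f :: "'a \<Rightarrow> real ^ 'n"
  assumes "f \<in> borel_measurable M"
  shows "(\<lambda>x. f x $ c) \<in> borel_measurable M"
  using measurable_compose[OF assms borel_measurable_continuous_onI[of "\<lambda>x. x $ c"]]
  by (simp add: continuous_on_component)

lemma atMost_vec_borel: "{..x :: real ^ 'n} \<in> sets borel"
  by (intro borel_closed) simp

text \<open>Every limit reduces to a one-dimensional cdf: the diagonal limits to that of the largest
  coordinate difference, the limit in a single coordinate to a bound by the marginal cdf.\<close>

lemma dist_fun_df_like:
  fixes \<mu> :: "(real ^ 'n) measure"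
  assumes "prob_space \<mu>" and sets: "sets \<mu> = sets borel"
  shows "df_like (dist_fun \<mu>)"
proof -
  interpret prob_space \<mu> by fact
  note [measurable_cong] = sets
  have sp: "space \<mu> = UNIV" using sets_eq_imp_space_eq[OF sets] by simp
  have mono: "mono (dist_fun \<mu>)"
    unfolding mono_def dist_fun_def
    by (intro allI impI finite_measure_mono) (auto simp: sets atMost_vec_borel)
  define m where "m x z = Max (range (\<lambda>c. z $ c - x $ c))" for x z :: "real ^ 'n"
  have [measurable]: "m x \<in> borel_measurable borel" for x
    unfolding m_def by (intro borel_measurable_Max) auto
  \<comment> \<open>Along the diagonal a distribution function is the cdf of a maximum of coordinates.\<close>
  have diag: "dist_fun \<mu> (shift_all x t) = cdf (distr \<mu> borel (m x)) t" for x t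
  proof -
    have "z \<in> {..shift_all x t} \<longleftrightarrow> m x z \<le> t" for z
      by (auto simp: m_def shift_all_def less_eq_vec_def algebra_simps)
    then have "{..shift_all x t} = {z. m x z \<le> t}" by blast
    also have "\<dots> = m x -` {..t} \<inter> space \<mu>" by (auto simp: sp)
    finally show ?thesis
      by (simp add: dist_fun_def cdf_def measure_distr)
  qed
  have rd: "real_distribution (distr \<mu> borel (m x))" for x
    by (intro real_distribution_distr) simp
  have fb: "finite_borel_measure (distr \<mu> borel (m x))" for x
    using rd[of x] real_distribution.finite_borel_measure_M by blast
  have "((\<lambda>t. dist_fun \<mu> (shift_all x t)) \<longlongrightarrow> dist_fun \<mu> x) (at_right 0)" for x
  proof -
    have "shift_all x 0 = x" by (simp add: shift_all_def vec_eq_iff)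
    then show ?thesis
      using finite_borel_measure.cdf_is_right_cont[OF fb[of x], of 0] diag[of x 0]
      by (simp add: diag continuous_within)
  qed
  moreover have "((\<lambda>t. dist_fun \<mu> (shift_all 0 t)) \<longlongrightarrow> 1) at_top"
    using real_distribution.cdf_lim_at_top_prob[OF rd[of 0]] by (simp add: diag)
  moreover have "((\<lambda>t. dist_fun \<mu> (replace_coord x c t)) \<longlongrightarrow> 0) at_bot" for x c
  proof (rule tendsto_sandwich[where f="\<lambda>_. 0" and h="cdf (distr \<mu> borel (\<lambda>z. z $ c))"])
    have "real_distribution (distr \<mu> borel (\<lambda>z. z $ c))"
      by (intro real_distribution_distr) simp
    then show "(cdf (distr \<mu> borel (\<lambda>z. z $ c)) \<longlongrightarrow> 0) at_bot"
      using finite_borel_measure.cdf_lim_at_bot real_distribution.finite_borel_measure_M by blast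
    show "\<forall>\<^sub>F t in at_bot. dist_fun \<mu> (replace_coord x c t) \<le> cdf (distr \<mu> borel (\<lambda>z. z $ c)) t"
    proof (intro always_eventually allI)
      fix t
      have "{..replace_coord x c t} \<subseteq> (\<lambda>z. z $ c) -` {..t} \<inter> space \<mu>"
        by (auto simp: sp replace_coord_def less_eq_vec_def split: if_splits)
      then show "dist_fun \<mu> (replace_coord x c t) \<le> cdf (distr \<mu> borel (\<lambda>z. z $ c)) t"
        unfolding dist_fun_def cdf_def by (subst measure_distr) (auto intro!: finite_measure_mono)
    qed
  qed (auto simp: dist_fun_def)
  ultimately show ?thesis using mono by (simp add: df_like_def)
qed

lemma is_dist_fun_df_like: "is_dist_fun F \<Longrightarrow> df_like F"
  unfolding is_dist_fun_def using dist_fun_df_like by blast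

lemma is_dist_fun_bounds: "is_dist_fun F \<Longrightarrow> 0 \<le> F x \<and> F x \<le> 1"
  unfolding is_dist_fun_def dist_fun_def by (auto simp: prob_space.prob_le_1)

text \<open>Needed for \<open>p u = Psi u powr (1 / real r)\<close>. Such a \<open>p\<close>
  preserves monotonicity and limits but may destroy non-negativity of rectangle increments, which is
  why the latter are left to \<open>dist_fun_limit\<close>.\<close>

lemma df_like_compose:
  assumes F: "df_like F" "\<And>x. F x \<in> {0..1}"
    and p: "mono_on {0..1} p" "continuous_on {0..1} p" "p 0 = 0" "p 1 = 1"
  shows "df_like (\<lambda>x. p (F x))"
proof -
  have lim: "((\<lambda>t. p (F (u t))) \<longlongrightarrow> p l) net" if "((\<lambda>t. F (u t)) \<longlongrightarrow> l) net" "l \<in> {0..1}"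
    for u :: "real \<Rightarrow> _" and l net
    by (rule continuous_on_tendsto_compose[OF p(2) that]) (use F(2) in auto)
  show ?thesis
    unfolding df_like_def
  proof (intro conjI allI)
    show "mono (\<lambda>x. p (F x))"
      using F p(1) by (auto simp: df_like_def mono_def mono_on_def)
    show "((\<lambda>t. p (F (shift_all x t))) \<longlongrightarrow> p (F x)) (at_right 0)" for x
      using F by (intro lim) (auto simp: df_like_def)
    show "((\<lambda>t. p (F (shift_all 0 t))) \<longlongrightarrow> 1) at_top"
      using lim[of "shift_all 0" 1 at_top] F(1) p(4) by (auto simp: df_like_def)
    show "((\<lambda>t. p (F (replace_coord x c t))) \<longlongrightarrow> 0) at_bot" for x c
      using lim[of "replace_coord x c" 0 at_bot] F(1) p(3) by (auto simp: df_like_def)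
  qed
qed

section \<open>Continuity points of monotone functions and separation of orthants\<close>

text \<open>A point near \<open>shift_all x t\<close> lies between two nearby points of the
  diagonal, and monotonicity squeezes the value of \<open>F\<close>.\<close>

lemma isCont_of_diagonal:
  fixes F :: "real ^ 'n \<Rightarrow> real"
  assumes "mono F" and "isCont (\<lambda>t. F (shift_all x t)) t"
  shows "isCont F (shift_all x t)"
  unfolding continuous_at_eps_delta
proof (intro allI impI)
  fix e :: real assume "0 < e"
  then obtain d where d: "d > 0" "\<And>s. \<bar>s - t\<bar> < d \<Longrightarrow> \<bar>F (shift_all x s) - F (shift_all x t)\<bar> < e"
    using assms(2) unfolding continuous_at_eps_delta dist_real_def by metis
  have "\<bar>F y - F (shift_all x t)\<bar> < e" if y: "dist y (shift_all x t) < d / 2" for y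
  proof -
    have "x $ c + (t - d / 2) \<le> y $ c \<and> y $ c \<le> x $ c + (t + d / 2)" for c
    proof -
      have "dist (y $ c) (shift_all x t $ c) \<le> dist y (shift_all x t)" by (rule dist_vec_nth_le)
      with y have "\<bar>y $ c - (x $ c + t)\<bar> < d / 2" by (simp add: dist_real_def shift_all_def)
      then show ?thesis unfolding abs_less_iff by linarith
    qed
    then have "shift_all x (t - d / 2) \<le> y" "y \<le> shift_all x (t + d / 2)"
      by (auto simp: less_eq_vec_def shift_all_def)
    then have "F (shift_all x (t - d / 2)) \<le> F y" "F y \<le> F (shift_all x (t + d / 2))"
      using assms(1) by (auto simp: mono_def)
    then show ?thesis
      using d(2)[of "t - d / 2"] d(2)[of "t + d / 2"] d(1) by (auto simp: abs_less_iff)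
  qed
  with d(1) show "\<exists>d>0. \<forall>y. dist y (shift_all x t) < d \<longrightarrow> dist (F y) (F (shift_all x t)) < e"
    by (intro exI[of _ "d / 2"]) (auto simp: dist_real_def)
qed

text \<open>A monotone function of one variable has only countably many discontinuities. This
  supplies points just above any \<open>x\<close> at which convergence of distribution functions may
  be used.\<close>

lemma continuity_point_above:
  fixes F :: "real ^ 'n \<Rightarrow> real"
  assumes "mono F" and "0 < e"
  shows "\<exists>t. 0 < t \<and> t < e \<and> isCont F (shift_all x t)"
proof -
  have "mono (\<lambda>t. F (shift_all x t))"
    using assms(1) by (auto simp: mono_def shift_all_def less_eq_vec_def)
  from open_minus_countable[OF mono_ctble_discont[OF this], of "{0<..<e}"] assms(2)
  obtain t where "t \<in> {0<..<e}" "isCont (\<lambda>t. F (shift_all x t)) t" by auto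
  with isCont_of_diagonal[OF assms(1)] show ?thesis by auto
qed

text \<open>The function falls linearly with the distance from \<open>{..w}\<close> and vanishes at
  distance \<delta>, the smallest gap between the coordinates of \<open>w\<close> and
  \<open>w'\<close>. It links weak convergence to probabilities of orthants.\<close>

lemma orthant_separation:
  fixes w w' :: "real ^ 'n"
  assumes "\<And>c. w $ c < w' $ c"
  shows "\<exists>f. continuous_on UNIV f \<and> (\<forall>z. \<bar>f z\<bar> \<le> 1) \<and>
    (\<forall>z. indicator {..w} z \<le> f z \<and> f z \<le> (indicator {..w'} z :: real))"
proof -
  define \<delta> where "\<delta> = Min (range (\<lambda>c. w' $ c - w $ c))"
  have \<delta>: "0 < \<delta>" using assms by (auto simp: \<delta>_def)
  have \<delta>c: "\<delta> \<le> w' $ c - w $ c" for c by (auto simp: \<delta>_def)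
  define f where "f z = max 0 (1 - infdist z {..w} / \<delta>)" for z
  have "continuous_on UNIV f"
    unfolding f_def using \<delta> by (intro continuous_intros) auto
  moreover have "\<bar>f z\<bar> \<le> 1" for z
    using \<delta> by (simp add: f_def infdist_nonneg)
  moreover have "indicator {..w} z \<le> f z" for z
    by (auto simp: f_def indicator_def)
  moreover have "f z \<le> indicator {..w'} z" for z
  proof (cases "z \<le> w'")
    case True
    then show ?thesis using \<delta> by (simp add: f_def infdist_nonneg)
  next
    case False
    have "\<delta> \<le> infdist z {..w}"
    proof (rule ccontr)
      assume "\<not> \<delta> \<le> infdist z {..w}"
      moreover have "{..w} \<noteq> {}" by auto
      ultimately obtain y where y: "y \<le> w" "dist z y < \<delta>"
        using infdist_notempty[of "{..w}" z] cINF_less_iff[of "{..w}" "dist z" \<delta>]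
        by (auto simp: bdd_below_image_dist)
      have "z $ c \<le> w' $ c" for c
      proof -
        have "dist (z $ c) (y $ c) < \<delta>" using dist_vec_nth_le[of z c y] y(2) by simp
        then show ?thesis using \<delta>c[of c] y(1) by (simp add: dist_real_def less_eq_vec_def) (smt (verit))
      qed
      with False show False by (simp add: less_eq_vec_def)
    qed
    with \<delta> False show ?thesis by (simp add: f_def)
  qed
  ultimately show ?thesis by blast
qed

section \<open>Pointwise limits of distribution functions\<close>

text \<open>The laws are carried into the open unit cube by \<open>T\<close>, and a subsequence
  converges weakly to some \<nu>. Squeezing between continuity points identifies \<nu> on orthants
  with \<open>F\<close>; the limits of \<open>F\<close> at infinity then put all mass of \<nu> on
  the open cube, so that it can be carried back by \<open>S\<close>.\<close>

lemma dist_fun_limit: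
  fixes F :: "real ^ 'n \<Rightarrow> real"
  assumes F: "df_like F"
    and Fs: "\<And>n. is_dist_fun (Fs n)"
    and lim: "dist_fun_tendsto Fs F sequentially"
  shows "is_dist_fun F"
proof -
  have "\<forall>n. \<exists>\<mu>. prob_space \<mu> \<and> sets \<mu> = sets borel \<and> Fs n = dist_fun \<mu>"
    using Fs by (simp add: is_dist_fun_def)
  then obtain \<mu> where \<mu>: "\<And>n. prob_space (\<mu> n)" "\<And>n. sets (\<mu> n) = sets borel"
    "\<And>n. Fs n = dist_fun (\<mu> n)" by metis
  have sp: "space (\<mu> n) = UNIV" for n using sets_eq_imp_space_eq[OF \<mu>(2)] by simp
  have mono: "mono F" using F by (simp add: df_like_def)
  \<comment> \<open>An increasing bijection of the line onto the open interval from 0 to 1, with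
    inverse \<open>tan (pi * (v - 1/2))\<close>; \<open>T\<close> and \<open>S\<close> apply the two
    maps in each coordinate.\<close>
  define s where "s u = arctan u / pi + 1/2" for u
  have s_less: "s u < s v \<longleftrightarrow> u < v" and s_le: "s u \<le> s v \<longleftrightarrow> u \<le> v" for u v
    by (auto simp: s_def divide_less_cancel divide_le_cancel arctan_less_iff arctan_le_iff)
  have s_range: "0 < s u" "s u < 1" for u
    using arctan_bounded[of u] by (auto simp: s_def field_simps)
  have s_inv: "s (tan (pi * (v - 1/2))) = v" if "0 < v" "v < 1" for v
  proof -
    have "- (pi/2) < pi * (v - 1/2)" "pi * (v - 1/2) < pi/2"
      using that by (auto simp: field_simps)
    then show ?thesis by (simp add: s_def arctan_tan)
  qed
  have s_cont: "isCont s u" for u unfolding s_def by (intro continuous_intros) auto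
  define T :: "real ^ 'n \<Rightarrow> real ^ 'n" where "T x = (\<chi> c. s (x $ c))" for x
  define S :: "real ^ 'n \<Rightarrow> real ^ 'n" where "S z = (\<chi> c. tan (pi * (z $ c - 1/2)))" for z
  have [measurable]: "s \<in> borel_measurable borel"
    by (intro borel_measurable_continuous_onI) (auto simp: continuous_on_eq_continuous_at s_cont)
  have T_meas [measurable]: "T \<in> borel_measurable borel"
    unfolding T_def by (intro borel_measurable_vec_lambda) measurable
  have tan_meas: "(tan :: real \<Rightarrow> real) \<in> borel_measurable borel"
    unfolding tan_def by measurable
  have S_meas [measurable]: "S \<in> borel_measurable borel"
    unfolding S_def by (intro borel_measurable_vec_lambda measurable_compose[OF _ tan_meas]) measurable
  have T_mu: "T \<in> borel_measurable (\<mu> n)" for n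
    using T_meas by (simp add: measurable_cong_sets[OF \<mu>(2) refl])
  define \<mu>' where "\<mu>' n = distr (\<mu> n) borel T" for n
  have \<mu>': "prob_space (\<mu>' n)" "sets (\<mu>' n) = sets borel" for n
    using prob_space.prob_space_distr[OF \<mu>(1) T_mu] by (auto simp: \<mu>'_def)
  have dist_T: "measure (\<mu>' n) {..T x} = Fs n x" for n x
  proof -
    have "T -` {..T x} \<inter> space (\<mu> n) = {..x}"
      by (auto simp: sp T_def less_eq_vec_def s_le)
    then show ?thesis
      using T_mu by (simp add: \<mu>'_def measure_distr atMost_vec_borel \<mu>(3) dist_fun_def)
  qed
  have "AE z in \<mu>' n. \<forall>c. 0 \<le> z $ c \<and> z $ c < 1" for n
  proof -
    have "AE x in \<mu> n. \<forall>c. 0 \<le> T x $ c \<and> T x $ c < 1"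
      by (simp add: T_def s_range less_imp_le)
    then show ?thesis
      unfolding \<mu>'_def using T_mu by (subst AE_distr_iff) auto
  qed
  then obtain r \<nu> where r: "strict_mono (r :: nat \<Rightarrow> nat)" and \<nu>: "prob_space \<nu>" "sets \<nu> = sets borel"
    and conv: "\<And>(f :: real ^ 'n \<Rightarrow> real) B. continuous_on UNIV f \<Longrightarrow> (\<And>z. \<bar>f z\<bar> \<le> B) \<Longrightarrow>
       (\<lambda>n. integral\<^sup>L (\<mu>' (r n)) f) \<longlonglongrightarrow> integral\<^sup>L \<nu> f"
    using weak_compactness_cube[of \<mu>', OF \<mu>'] by blast
  interpret \<nu>: prob_space \<nu> by fact
  have sp\<nu>: "space \<nu> = UNIV" using sets_eq_imp_space_eq[OF \<nu>(2)] by simp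
  have squeeze: "measure \<mu> {..w} \<le> integral\<^sup>L \<mu> f \<and> integral\<^sup>L \<mu> f \<le> measure \<mu> {..w'}"
    if "prob_space \<mu>" "sets \<mu> = sets borel" "continuous_on UNIV f" "\<And>z. \<bar>f z\<bar> \<le> 1"
      "\<And>z. indicator {..w} z \<le> f z \<and> f z \<le> (indicator {..w'} z :: real)"
    for \<mu> :: "(real ^ 'n) measure" and f w w'
  proof -
    interpret prob_space \<mu> by fact
    have ind: "integrable \<mu> (indicator {..v} :: _ \<Rightarrow> real)" for v
      using that(2) atMost_vec_borel by (intro integrable_real_indicator) (auto simp: emeasure_eq_measure)
    have f: "integrable \<mu> f"
      using borel_measurable_continuous_onI[OF that(3)] that(2,4)
      by (intro integrable_const_bound[where B=1]) (auto simp: measurable_cong_sets[OF that(2) refl])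
    have "integral\<^sup>L \<mu> (indicator {..w}) \<le> integral\<^sup>L \<mu> f" "integral\<^sup>L \<mu> f \<le> integral\<^sup>L \<mu> (indicator {..w'})"
      using that(5) by (intro integral_mono ind f; blast)+
    moreover have "space \<mu> = UNIV" using sets_eq_imp_space_eq[OF that(2)] by simp
    ultimately show ?thesis by simp
  qed
  have above: "measure \<nu> {..T x} \<le> F y" if xy: "isCont F y" "\<And>c. x $ c < y $ c" for x y
  proof -
    obtain f where f: "continuous_on UNIV f" "\<And>z. \<bar>f z\<bar> \<le> 1"
      "\<And>z. indicator {..T x} z \<le> f z \<and> f z \<le> (indicator {..T y} z :: real)"
      using orthant_separation[of "T x" "T y"] xy(2) by (auto simp: T_def s_less)
    have "(\<lambda>n. Fs (r n) y) \<longlonglongrightarrow> F y"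
      using lim xy(1) LIMSEQ_subseq_LIMSEQ[OF _ r] by (auto simp: dist_fun_tendsto_def o_def)
    then have "integral\<^sup>L \<nu> f \<le> F y"
      using squeeze[OF \<mu>' f] dist_T by (intro LIMSEQ_le[OF conv[OF f(1,2)]]) auto
    with squeeze[OF \<nu> f] show ?thesis by linarith
  qed
  \<comment> \<open>Here \<open>w\<close> need not be of the form \<open>T y\<close>: it will be
    \<open>shift_all (T x) \<delta>\<close>, which may lie outside the cube.\<close>
  have below: "F x \<le> measure \<nu> {..w}" if xw: "isCont F x" "\<And>c. T x $ c < w $ c" for x w
  proof -
    obtain f where f: "continuous_on UNIV f" "\<And>z. \<bar>f z\<bar> \<le> 1"
      "\<And>z. indicator {..T x} z \<le> f z \<and> f z \<le> (indicator {..w} z :: real)"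
      using orthant_separation[of "T x" w] xw(2) by auto
    have "(\<lambda>n. Fs (r n) x) \<longlonglongrightarrow> F x"
      using lim xw(1) LIMSEQ_subseq_LIMSEQ[OF _ r] by (auto simp: dist_fun_tendsto_def o_def)
    then have "F x \<le> integral\<^sup>L \<nu> f"
      using squeeze[OF \<mu>' f] dist_T by (intro LIMSEQ_le[OF _ conv[OF f(1,2)]]) auto
    with squeeze[OF \<nu> f] show ?thesis by linarith
  qed
  \<comment> \<open>Continuity points approach \<open>x\<close> from above. Right continuity of
    \<open>F\<close> turns \<open>above\<close> into one inequality, right continuity of the
    distribution function of \<nu> turns \<open>below\<close> into the other.\<close>
  have eq: "measure \<nu> {..T x} = F x" for x
  proof (rule antisym)
    show "measure \<nu> {..T x} \<le> F x"
    proof (rule ccontr)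
      assume "\<not> measure \<nu> {..T x} \<le> F x"
      moreover have "((\<lambda>t. F (shift_all x t)) \<longlongrightarrow> F x) (at_right 0)"
        using F by (simp add: df_like_def)
      ultimately have "\<forall>\<^sub>F t in at_right 0. F (shift_all x t) < measure \<nu> {..T x}"
        by (intro order_tendstoD) auto
      then obtain e where e: "e > 0" "\<And>t. 0 < t \<Longrightarrow> t < e \<Longrightarrow> F (shift_all x t) < measure \<nu> {..T x}"
        by (auto simp: eventually_at_right_field)
      obtain t where t: "0 < t" "t < e" "isCont F (shift_all x t)"
        using continuity_point_above[OF mono e(1)] by blast
      with above[OF t(3), of x] e(2)[OF t(1,2)] show False by (simp add: shift_all_def)
    qed
    show "F x \<le> measure \<nu> {..T x}"
    proof (rule tendsto_lowerbound)
      show "((\<lambda>t. dist_fun \<nu> (shift_all (T x) t)) \<longlongrightarrow> measure \<nu> {..T x}) (at_right 0)"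
        using dist_fun_df_like[OF \<nu>] by (simp add: df_like_def dist_fun_def[symmetric])
      have "F x \<le> dist_fun \<nu> (shift_all (T x) \<delta>)" if "\<delta> > 0" for \<delta>
      proof -
        have "\<forall>\<^sub>F t in at_right 0. s (x $ c + t) < s (x $ c) + \<delta>" for c
        proof (rule order_tendstoD(2))
          have "isCont (\<lambda>t. s (x $ c + t)) 0"
            by (intro isCont_o2[OF _ s_cont] continuous_intros)
          then show "((\<lambda>t. s (x $ c + t)) \<longlongrightarrow> s (x $ c)) (at_right 0)"
            by (auto simp: isCont_def intro: tendsto_mono[OF at_le])
        qed (use that in auto)
        then have "\<forall>\<^sub>F t in at_right 0. \<forall>c. s (x $ c + t) < s (x $ c) + \<delta>"
          by (simp add: eventually_all_finite)
        then obtain e where e: "e > 0" "\<And>t c. 0 < t \<Longrightarrow> t < e \<Longrightarrow> s (x $ c + t) < s (x $ c) + \<delta>"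
          by (auto simp: eventually_at_right_field)
        obtain t where t: "0 < t" "t < e" "isCont F (shift_all x t)"
          using continuity_point_above[OF mono e(1)] by blast
        have "F x \<le> F (shift_all x t)"
          using t mono by (auto simp: mono_def shift_all_def less_eq_vec_def)
        also have "\<dots> \<le> measure \<nu> {..shift_all (T x) \<delta>}"
          using e(2)[OF t(1,2)] by (intro below[OF t(3)]) (auto simp: T_def shift_all_def)
        finally show ?thesis by (simp add: dist_fun_def)
      qed
      then show "\<forall>\<^sub>F \<delta> in at_right 0. F x \<le> dist_fun \<nu> (shift_all (T x) \<delta>)"
        by (auto simp: eventually_at_right_field intro: exI[of _ 1])
    qed auto
  qed
  define good where "good = {z :: real ^ 'n. \<forall>c. 0 < z $ c \<and> z $ c < 1}"
  have good_sets: "good \<in> sets borel"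
    unfolding good_def by measurable
  have "F (shift_all 0 u) \<le> measure \<nu> good" for u
  proof -
    let ?o = "shift_all 0 u :: real ^ 'n"
    \<comment> \<open>Mass of \<nu> on the boundary of the cube would be mass lost to infinity. A
      point below \<open>T ?o\<close> but outside \<open>good\<close> has some coordinate at most 0,
      hence lies below \<open>T (replace_coord ?o c t)\<close> for every \<open>t\<close>; then
      \<open>t\<close> goes to minus infinity.\<close>
    have le: "F ?o \<le> measure \<nu> good + (\<Sum>c\<in>UNIV. F (replace_coord ?o c t))" for t
    proof -
      have "{..T ?o} \<subseteq> good \<union> (\<Union>c\<in>UNIV. {..T (replace_coord ?o c t)})"
      proof
        fix z assume z: "z \<in> {..T ?o}"
        then have z1: "z $ c < 1" and zo: "z $ c \<le> s u" for c
          using s_range[of u] by (auto simp: T_def less_eq_vec_def shift_all_def intro: le_less_trans)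
        show "z \<in> good \<union> (\<Union>c\<in>UNIV. {..T (replace_coord ?o c t)})"
        proof (cases "z \<in> good")
          case False
          then obtain c where "z $ c \<le> 0" using z1 by (auto simp: good_def not_less)
          then have "z \<le> T (replace_coord ?o c t)"
            using zo s_range(1)[of t]
            by (auto simp: T_def less_eq_vec_def shift_all_def replace_coord_def)
          then show ?thesis by blast
        qed simp
      qed
      then have "measure \<nu> {..T ?o} \<le> measure \<nu> (good \<union> (\<Union>c\<in>UNIV. {..T (replace_coord ?o c t)}))"
        using good_sets by (intro \<nu>.finite_measure_mono) (auto simp: \<nu>(2) atMost_vec_borel)
      also have "\<dots> \<le> measure \<nu> good + measure \<nu> (\<Union>c\<in>UNIV. {..T (replace_coord ?o c t)})"
        using good_sets by (intro measure_Un_le) (auto simp: \<nu>(2) atMost_vec_borel)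
      also have "measure \<nu> (\<Union>c\<in>UNIV. {..T (replace_coord ?o c t)})
          \<le> (\<Sum>c\<in>UNIV. measure \<nu> {..T (replace_coord ?o c t)})"
        by (intro measure_UNION_le) (auto simp: \<nu>(2) atMost_vec_borel)
      finally show ?thesis by (simp add: eq)
    qed
    have "((\<lambda>t. measure \<nu> good + (\<Sum>c\<in>UNIV. F (replace_coord ?o c t))) \<longlongrightarrow>
        measure \<nu> good + (\<Sum>c\<in>(UNIV::'n set). 0)) at_bot"
      using F by (intro tendsto_intros) (auto simp: df_like_def)
    from tendsto_lowerbound[OF this, of "F ?o"] le show ?thesis by auto
  qed
  moreover have "((\<lambda>t. F (shift_all 0 t)) \<longlongrightarrow> 1) at_top"
    using F by (simp add: df_like_def)
  ultimately have "1 \<le> measure \<nu> good"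
    by (intro tendsto_upperbound[of "\<lambda>t. F (shift_all 0 t)" 1 at_top]) auto
  then have "measure \<nu> good = 1" using \<nu>.prob_le_1[of good] by linarith
  then have ae: "AE z in \<nu>. z \<in> good"
    using good_sets by (subst (asm) \<nu>.prob_eq_1) (auto simp: \<nu>(2))
  have S_nu: "S \<in> borel_measurable \<nu>"
    using S_meas by (simp add: measurable_cong_sets[OF \<nu>(2) refl])
  have "F x = dist_fun (distr \<nu> borel S) x" for x
  proof -
    have "dist_fun (distr \<nu> borel S) x = measure \<nu> (S -` {..x} \<inter> space \<nu>)"
      using S_nu by (simp add: dist_fun_def measure_distr atMost_vec_borel)
    also have "\<dots> = measure \<nu> {..T x}"
    proof (rule \<nu>.finite_measure_eq_AE)
      show "AE z in \<nu>. (z \<in> S -` {..x} \<inter> space \<nu>) = (z \<in> {..T x})"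
        using ae
      proof eventually_elim
        case (elim z)
        have "tan (pi * (z $ c - 1/2)) \<le> x $ c \<longleftrightarrow> z $ c \<le> s (x $ c)" for c
          using s_le[of "tan (pi * (z $ c - 1/2))" "x $ c"] s_inv[of "z $ c"] elim
          by (simp add: good_def)
        then show ?case by (simp add: sp\<nu> S_def T_def less_eq_vec_def)
      qed
    qed (use measurable_sets[OF S_nu, of "{..x}"] in \<open>auto simp: \<nu>(2) atMost_vec_borel\<close>)
    finally show ?thesis by (simp add: eq)
  qed
  then show ?thesis
    unfolding is_dist_fun_def using \<nu>.prob_space_distr[OF S_nu]
    by (intro exI[of _ "distr \<nu> borel S"]) auto
qed

section \<open>Random maxima\<close>

lemma rand_max_le_iff:
  "rand_max N Y \<omega> \<le> (\<chi> c. ereal (x $ c)) \<longleftrightarrow> (\<forall>i\<in>{1..N \<omega>}. Y i \<omega> \<le> x)"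
  by (auto simp: rand_max_def less_eq_vec_def SUP_le_iff)

text \<open>The event is split according to the value of \<open>N\<close>; independence gives each
  piece the probability \<open>prob (A n) * h ^ n\<close>. For \<open>n = 0\<close> the factor is 1,
  in agreement with the empty maximum being below every \<open>x\<close>.\<close>

lemma max_model_ext_dist_fun:
  fixes Y :: "nat \<Rightarrow> 'a \<Rightarrow> real ^ 'n"
  assumes "max_model M N Y"
  shows "ext_dist_fun M (rand_max N Y) x = (\<integral>\<omega>. dist_fun (distr M borel (Y 1)) x ^ N \<omega> \<partial>M)"
proof -
  interpret prob_space M using assms by (simp add: max_model_def)
  have N [measurable]: "N \<in> measurable M (count_space UNIV)" and iv: "indep_vars (\<lambda>_. borel) Y {1..}"
    and id: "\<And>i. i \<ge> 1 \<Longrightarrow> distr M borel (Y i) = distr M borel (Y 1)"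
    and iN: "indep_of_sequence M N Y"
    using assms unfolding max_model_def iid_vectors_def by blast+
  have Y [measurable]: "Y i \<in> borel_measurable M" if "i \<ge> 1" for i
    using iv that by (auto simp: indep_vars_def2)
  define h where "h = dist_fun (distr M borel (Y 1)) x"
  have h: "0 \<le> h" "h \<le> 1"
    using prob_space.prob_le_1[OF prob_space_distr[OF Y[of 1]]] by (auto simp: h_def dist_fun_def)
  define E where "E n = {\<omega>\<in>space M. \<forall>i\<in>{1..n}. Y i \<omega> \<le> x}" for n
  define A where "A n = {\<omega>\<in>space M. N \<omega> = n}" for n
  have A_sets [measurable]: "A n \<in> events" for n unfolding A_def by measurable
  have E_prob: "prob (E n) = h ^ n" for n
  proof (cases "n = 0")
    case False
    have one: "prob (Y i -` {..x} \<inter> space M) = h" if "i \<in> {1..n}" for i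
    proof -
      have "h = dist_fun (distr M borel (Y i)) x" using id[of i] that by (simp add: h_def)
      also have "\<dots> = prob (Y i -` {..x} \<inter> space M)"
        using that by (simp add: dist_fun_def measure_distr atMost_vec_borel)
      finally show ?thesis by simp
    qed
    have "E n = (\<Inter>i\<in>{1..n}. Y i -` {..x} \<inter> space M)"
      using False by (auto simp: E_def)
    also have "prob \<dots> = (\<Prod>i\<in>{1..n}. prob (Y i -` {..x} \<inter> space M))"
      using False by (intro indep_varsD[OF iv]) (auto simp: atMost_vec_borel)
    also have "\<dots> = h ^ n" using one by simp
    finally show ?thesis .
  qed (simp add: E_def prob_space)
  have AE_prob: "prob (A n \<inter> E n) = prob (A n) * h ^ n" and E_sets [measurable]: "E n \<in> events" for n
  proof -
    \<comment> \<open>\<open>E n\<close> has to be exhibited as an event generated by the whole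
      sequence, the form in which independence from \<open>N\<close> is available.\<close>
    let ?B = "{y \<in> space (\<Pi>\<^sub>M i\<in>{1..}. (borel :: (real ^ 'n) measure)). \<forall>i\<in>{1..n}. y i \<in> {..x}}"
    have "?B \<in> sets (\<Pi>\<^sub>M i\<in>{1..}. (borel :: (real ^ 'n) measure))"
      by (intro sets.sets_Collect_finite_All sets_Collect_single') (auto simp: atMost_vec_borel)
    moreover have "E n = (\<lambda>\<omega>. \<lambda>i\<in>{1..}. Y i \<omega>) -` ?B \<inter> space M"
      by (auto simp: E_def space_PiM)
    ultimately have 1: "E n \<in> {(\<lambda>\<omega>. \<lambda>i\<in>{1..}. Y i \<omega>) -` B \<inter> space M | B.
        B \<in> sets (\<Pi>\<^sub>M i\<in>{1..}. borel)}" by blast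
    have "A n = N -` {n} \<inter> space M" by (auto simp: A_def)
    then have 2: "A n \<in> {N -` A \<inter> space M | A. A \<in> sets (count_space UNIV)}" by auto
    show "prob (A n \<inter> E n) = prob (A n) * h ^ n"
      using indep_setD[OF iN[unfolded indep_of_sequence_def] 2 1] by (simp add: E_prob)
    show "E n \<in> events"
      using indep_setD_ev2[OF iN[unfolded indep_of_sequence_def]] 1 by blast
  qed
  have disj: "disjoint_family A" by (auto simp: disjoint_family_on_def A_def)
  have "ennreal (ext_dist_fun M (rand_max N Y) x) = emeasure M (\<Union>n. A n \<inter> E n)"
  proof -
    have "{\<omega> \<in> space M. rand_max N Y \<omega> \<le> (\<chi> c. ereal (x $ c))} = (\<Union>n. A n \<inter> E n)"
      by (auto simp: rand_max_le_iff A_def E_def)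
    then show ?thesis by (simp add: ext_dist_fun_def emeasure_eq_measure)
  qed
  also have "\<dots> = (\<Sum>n. emeasure M (A n \<inter> E n))"
    using disj by (intro suminf_emeasure[symmetric]) (auto simp: disjoint_family_on_def)
  also have "\<dots> = (\<Sum>n. ennreal (h ^ n) * emeasure M (A n))"
    using h by (simp add: emeasure_eq_measure AE_prob ennreal_mult[symmetric] mult.commute)
  also have "\<dots> = (\<Sum>n. \<integral>\<^sup>+\<omega>. ennreal (h ^ n) * indicator (A n) \<omega> \<partial>M)"
    by (simp add: nn_integral_cmult_indicator)
  also have "\<dots> = (\<integral>\<^sup>+\<omega>. (\<Sum>n. ennreal (h ^ n) * indicator (A n) \<omega>) \<partial>M)"
    by (intro nn_integral_suminf[symmetric]) measurable
  also have "\<dots> = (\<integral>\<^sup>+\<omega>. ennreal (h ^ N \<omega>) \<partial>M)"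
    by (intro nn_integral_cong suminf_cmult_indicator[OF disj]) (auto simp: A_def)
  also have "\<dots> = ennreal (\<integral>\<omega>. h ^ N \<omega> \<partial>M)"
    using h by (intro nn_integral_eq_integral integrable_const_bound[where B=1]) (auto simp: power_le_one)
  finally show ?thesis
    using h by (simp add: h_def ext_dist_fun_def)
qed

section \<open>Mixed Poisson laws and the generating functions of the class\<close>

text \<open>Replaces \<open>Z\<close> by a variable that is non-negative everywhere, so that it can
  serve as a Poisson rate at every point.\<close>

lemma laplace_transform_abs:
  assumes "Z \<in> borel_measurable M" "AE \<omega> in M. 0 < Z \<omega>"
  shows "laplace_transform M (\<lambda>\<omega>. \<bar>Z \<omega>\<bar>) = laplace_transform M Z"
  unfolding laplace_transform_def using assms(1)
  by (intro ext integral_cong_AE eventually_mono[OF assms(2)]) auto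

text \<open>A Poisson law of rate \<open>L\<close> has generating function
  \<open>exp (- L * (1 - s))\<close>. Averaging over \<open>L = \<bar>Z\<bar> / \<theta>\<close>
  gives the Laplace transform of \<open>Z\<close> at \<open>(1 - s) / \<theta>\<close>.\<close>

lemma mixed_poisson_pmf:
  fixes \<theta> :: real
  assumes "prob_space M" and Z [measurable]: "Z \<in> borel_measurable M" and pos: "AE \<omega> in M. 0 < Z \<omega>"
    and "\<theta> > 0"
  shows "\<exists>p :: nat pmf. \<forall>s\<in>{0..1}.
    measure_pmf.expectation p (\<lambda>n. s ^ n) = laplace_transform M Z ((1 - s) / \<theta>)"
proof -
  interpret prob_space M by fact
  define L where "L \<omega> = \<bar>Z \<omega>\<bar> / \<theta>" for \<omega>
  have L0: "0 \<le> L \<omega>" for \<omega> using \<open>\<theta> > 0\<close> by (simp add: L_def)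
  have [measurable]: "L \<in> borel_measurable M" unfolding L_def by measurable
  define q where "q n \<omega> = L \<omega> ^ n / fact n * exp (- L \<omega>)" for n \<omega>
  have q: "0 \<le> q n \<omega>" "q n \<omega> \<le> 1" for n \<omega>
  proof -
    show "0 \<le> q n \<omega>" using L0[of \<omega>] by (simp add: q_def)
    show "q n \<omega> \<le> 1"
    proof (cases "L \<omega> = 0")
      case False
      then have "0 < L \<omega>" using L0[of \<omega>] by simp
      then show ?thesis
        using pmf_le_1[of "poisson_pmf (L \<omega>)" n] by (simp only: q_def pmf_poisson)
    qed (simp add: q_def power_0_left)
  qed
  have [measurable]: "q n \<in> borel_measurable M" for n unfolding q_def by measurable
  have qi: "integrable M (q n)" for n
    using q by (intro integrable_const_bound[where B=1]) auto
  define f where "f n = (\<integral>\<omega>. q n \<omega> \<partial>M)" for n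
  have f0: "0 \<le> f n" for n unfolding f_def using q by (intro integral_nonneg_AE) auto
  have key: "(\<Sum>n. ennreal (f n * s ^ n)) = ennreal (laplace_transform M Z ((1 - s) / \<theta>))"
    if s: "s \<in> {0..1}" for s
  proof -
    have "ennreal (f n * s ^ n) = (\<integral>\<^sup>+\<omega>. ennreal (q n \<omega> * s ^ n) \<partial>M)" for n
      using s q by (subst nn_integral_eq_integral) (auto simp: f_def intro!: qi)
    then have "(\<Sum>n. ennreal (f n * s ^ n)) = (\<integral>\<^sup>+\<omega>. (\<Sum>n. ennreal (q n \<omega> * s ^ n)) \<partial>M)"
      by (simp add: nn_integral_suminf)
    also have "\<dots> = (\<integral>\<^sup>+\<omega>. ennreal (exp (- ((1 - s) / \<theta> * \<bar>Z \<omega>\<bar>))) \<partial>M)"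
    proof (intro nn_integral_cong suminf_ennreal_eq)
      fix \<omega>
      show "0 \<le> q n \<omega> * s ^ n" for n using q s by simp
      have "(\<lambda>n. exp (- L \<omega>) * ((L \<omega> * s) ^ n /\<^sub>R fact n)) sums (exp (- L \<omega>) * exp (L \<omega> * s))"
        by (intro sums_mult exp_converges)
      moreover have "exp (- L \<omega>) * exp (L \<omega> * s) = exp (- ((1 - s) / \<theta> * \<bar>Z \<omega>\<bar>))"
        by (simp add: exp_add[symmetric] L_def algebra_simps diff_divide_distrib)
      moreover have "(\<lambda>n. exp (- L \<omega>) * ((L \<omega> * s) ^ n /\<^sub>R fact n)) = (\<lambda>n. q n \<omega> * s ^ n)"
        by (simp add: q_def power_mult_distrib field_simps)
      ultimately show "(\<lambda>n. q n \<omega> * s ^ n) sums exp (- ((1 - s) / \<theta> * \<bar>Z \<omega>\<bar>))" by simp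
    qed
    also have "\<dots> = ennreal (laplace_transform M (\<lambda>\<omega>. \<bar>Z \<omega>\<bar>) ((1 - s) / \<theta>))"
      unfolding laplace_transform_def using s \<open>\<theta> > 0\<close>
      by (intro nn_integral_eq_integral integrable_const_bound[where B=1]) auto
    finally show ?thesis using laplace_transform_abs[OF Z pos] by simp
  qed
  have "(\<integral>\<^sup>+n. ennreal (f n) \<partial>count_space UNIV) = 1"
    using key[of 1] by (simp add: nn_integral_count_space_nat laplace_transform_def prob_space)
  \<comment> \<open>The case \<open>s = 1\<close> of \<open>key\<close> shows that the weights
    \<open>f n\<close> sum to 1, the transform being 1 at 0.\<close>
  note pf = pmf_embed_pmf[OF f0 this]
  have "measure_pmf.expectation (embed_pmf f) (\<lambda>n. s ^ n) = laplace_transform M Z ((1 - s) / \<theta>)"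
    if s: "s \<in> {0..1}" for s
  proof -
    have "ennreal (measure_pmf.expectation (embed_pmf f) (\<lambda>n. s ^ n))
        = (\<integral>\<^sup>+n. ennreal (s ^ n) \<partial>measure_pmf (embed_pmf f))"
      using s by (intro nn_integral_eq_integral[symmetric]
          measure_pmf.integrable_const_bound[where B=1]) (auto simp: power_le_one)
    also have "\<dots> = (\<Sum>n. ennreal (f n * s ^ n))"
      using s f0 by (simp add: nn_integral_measure_pmf pf nn_integral_count_space_nat ennreal_mult)
    finally show ?thesis
      using key[OF s] s by (simp add: laplace_transform_def)
  qed
  then show ?thesis by blast
qed

text \<open>If \<open>N\<close> is the mixed Poisson count, then \<open>j + k * N\<close> has
  generating function \<open>s ^ j\<close> times that of \<open>N\<close> at
  \<open>s ^ k\<close>.\<close>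

lemma phi_pgf_pmf:
  fixes \<theta> :: real
  assumes "prob_space M" "Z \<in> borel_measurable M" "AE \<omega> in M. 0 < Z \<omega>" "\<theta> > 0"
  shows "\<exists>p :: nat pmf. \<forall>s\<in>{0..1}.
    measure_pmf.expectation p (\<lambda>n. s ^ n) = phi_pgf (laplace_transform M Z) j k \<theta> s"
proof -
  obtain p :: "nat pmf" where p: "\<And>s. s \<in> {0..1} \<Longrightarrow>
      measure_pmf.expectation p (\<lambda>n. s ^ n) = laplace_transform M Z ((1 - s) / \<theta>)"
    using mixed_poisson_pmf[OF assms] by blast
  have "measure_pmf.expectation (map_pmf (\<lambda>n. j + k * n) p) (\<lambda>n. s ^ n)
      = phi_pgf (laplace_transform M Z) j k \<theta> s" if s: "s \<in> {0..1}" for s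
    using p[of "s ^ k"] s by (simp add: phi_pgf_def power_add power_mult power_le_one)
  then show ?thesis by blast
qed

section \<open>Realisation of a random count and an i.i.d. sequence on a product space\<close>

lemma measure_pair_Times:
  assumes "prob_space M" "prob_space N" "A \<in> sets M" "B \<in> sets N"
  shows "measure (M \<Otimes>\<^sub>M N) (A \<times> B) = measure M A * measure N B"
proof -
  interpret N: prob_space N by fact
  show ?thesis
    by (simp add: measure_def enn2real_mult N.emeasure_pair_measure_Times[OF assms(3,4)])
qed

lemma max_model_exists:
  fixes \<mu> :: "(real ^ 'n) measure" and p :: "nat pmf"
  assumes "prob_space \<mu>" and sets: "sets \<mu> = sets borel"
  defines "M \<equiv> measure_pmf p \<Otimes>\<^sub>M (\<Pi>\<^sub>M i\<in>UNIV. \<mu>)"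
  shows "max_model M fst (\<lambda>i \<omega>. snd \<omega> i)"
    and "distr M borel (\<lambda>\<omega>. snd \<omega> 1) = \<mu>"
    and "(\<integral>\<omega>. (s::real) ^ fst \<omega> \<partial>M) = measure_pmf.expectation p (\<lambda>n. s ^ n)"
proof -
  interpret \<mu>: prob_space \<mu> by fact
  interpret P: product_prob_space "\<lambda>_::nat. \<mu>" UNIV ..
  have PiM: "prob_space (\<Pi>\<^sub>M i\<in>(UNIV::nat set). \<mu>)" by (rule P.prob_space_axioms)
  interpret M: prob_space M
    unfolding M_def by (intro prob_space_pair PiM measure_pmf.prob_space_axioms)
  have sp\<mu>: "space \<mu> = UNIV" using sets_eq_imp_space_eq[OF sets] by simp
  have spP: "space (\<Pi>\<^sub>M i\<in>(UNIV::nat set). \<mu>) = UNIV" by (simp add: space_PiM sp\<mu>)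
  have spM: "space M = UNIV" by (simp add: M_def space_pair_measure spP)
  have times: "M.prob (a \<times> b) = measure (measure_pmf p) a * measure (\<Pi>\<^sub>M i\<in>UNIV. \<mu>) b"
    if "b \<in> sets (\<Pi>\<^sub>M i\<in>UNIV. \<mu>)" for a b
    unfolding M_def using that PiM measure_pmf.prob_space_axioms by (intro measure_pair_Times) auto
  have fst_meas: "fst \<in> measurable M (count_space UNIV)"
    unfolding M_def using measurable_fst[of "measure_pmf p" "\<Pi>\<^sub>M i\<in>UNIV. \<mu>"]
    by (simp add: measurable_cong_sets[OF refl, of "measure_pmf p" "count_space UNIV"])
  have Y_meas: "(\<lambda>\<omega>. snd \<omega> i) \<in> measurable M \<mu>" for i
    unfolding M_def by measurable
  then have Y_borel: "(\<lambda>\<omega>. snd \<omega> i) \<in> borel_measurable M" for i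
    by (simp add: measurable_cong_sets[OF refl sets])
  have distr_Y: "distr M borel (\<lambda>\<omega>. snd \<omega> i) = \<mu>" for i
  proof (rule measure_eqI)
    fix A assume "A \<in> sets (distr M borel (\<lambda>\<omega>. snd \<omega> i))"
    then have A: "A \<in> sets borel" "A \<in> sets \<mu>" by (auto simp: sets)
    let ?C = "{y \<in> space (\<Pi>\<^sub>M i\<in>(UNIV::nat set). \<mu>). y i \<in> A}"
    have "?C \<in> sets (\<Pi>\<^sub>M i\<in>UNIV. \<mu>)"
      using A by (intro sets_Collect_single') (auto simp: sp\<mu>)
    moreover have "(\<lambda>\<omega>. snd \<omega> i) -` A \<inter> space M = UNIV \<times> ?C"
      by (auto simp: spM spP)
    moreover have "measure (\<Pi>\<^sub>M i\<in>UNIV. \<mu>) ?C = measure \<mu> A"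
      using P.emeasure_PiM_Collect_single[of i A] A by (simp add: measure_def)
    ultimately show "emeasure (distr M borel (\<lambda>\<omega>. snd \<omega> i)) A = emeasure \<mu> A"
      using A Y_borel by (simp add: emeasure_distr M.emeasure_eq_measure \<mu>.emeasure_eq_measure times)
  qed (simp add: sets)
  show "distr M borel (\<lambda>\<omega>. snd \<omega> 1) = \<mu>" by (rule distr_Y)
  have iv: "M.indep_vars (\<lambda>_. borel) (\<lambda>i \<omega>. snd \<omega> i) {1..}"
    unfolding M.indep_vars_def2
  proof (intro conjI ballI Y_borel M.indep_setsI)
    fix i
    show "{(\<lambda>\<omega>. snd \<omega> i) -` A \<inter> space M |A. A \<in> sets borel} \<subseteq> M.events"
      using measurable_sets[OF Y_borel[of i]] by blast
  next
    fix A J assume J: "J \<noteq> {}" "J \<subseteq> {1::nat..}" "finite J"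
      and A: "\<forall>j\<in>J. A j \<in> {(\<lambda>\<omega>. snd \<omega> j) -` A \<inter> space M |A. A \<in> sets borel}"
    then obtain B where B: "\<And>j. j \<in> J \<Longrightarrow> B j \<in> sets borel" "\<And>j. j \<in> J \<Longrightarrow> A j = (\<lambda>\<omega>. snd \<omega> j) -` B j"
      by (simp add: spM) metis
    have "(\<Inter>j\<in>J. A j) = UNIV \<times> {y \<in> space (\<Pi>\<^sub>M i\<in>UNIV. \<mu>). \<forall>j\<in>J. y j \<in> B j}"
      using B(2) by (auto simp: spP)
    moreover have "{y \<in> space (\<Pi>\<^sub>M i\<in>UNIV. \<mu>). \<forall>j\<in>J. y j \<in> B j} \<in> sets (\<Pi>\<^sub>M i\<in>UNIV. \<mu>)"
      using B J by (intro sets.sets_Collect_finite_All sets_Collect_single') (auto simp: sets sp\<mu>)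
    moreover have "measure (\<Pi>\<^sub>M i\<in>UNIV. \<mu>) {y \<in> space (\<Pi>\<^sub>M i\<in>UNIV. \<mu>). \<forall>j\<in>J. y j \<in> B j}
        = (\<Prod>j\<in>J. measure \<mu> (B j))"
      using P.emeasure_PiM_Collect[of J B] J B(1)
      by (simp add: sets P.emeasure_eq_measure \<mu>.emeasure_eq_measure prod_ennreal prod_nonneg)
    moreover have "measure \<mu> (B j) = M.prob (A j)" if "j \<in> J" for j
      using distr_Y[of j] B that Y_borel[of j] measure_distr[of "\<lambda>\<omega>. snd \<omega> j" M borel "B j"]
      by (simp add: spM)
    ultimately show "M.prob (\<Inter>j\<in>J. A j) = (\<Prod>j\<in>J. M.prob (A j))"
      by (simp add: times)
  qed
  have rm: "(\<lambda>y. \<lambda>i\<in>{1..}. y i) \<in> measurable (\<Pi>\<^sub>M i\<in>(UNIV::nat set). \<mu>) (\<Pi>\<^sub>M i\<in>{1..}. borel)"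
    by (intro measurable_restrict) (simp add: measurable_cong_sets[OF refl sets[symmetric]])
  have "indep_of_sequence M fst (\<lambda>i \<omega>. snd \<omega> i)"
    unfolding indep_of_sequence_def
  proof (rule M.indep_setI)
    show "{fst -` A \<inter> space M |A. A \<in> sets (count_space UNIV)} \<subseteq> M.events"
      using measurable_sets[OF fst_meas] by blast
    have "(\<lambda>\<omega>. \<lambda>i\<in>{1..}. snd \<omega> i) \<in> measurable M (\<Pi>\<^sub>M i\<in>{1..}. borel)"
      by (intro measurable_restrict Y_borel)
    then show "{(\<lambda>\<omega>. \<lambda>i\<in>{1..}. snd \<omega> i) -` B \<inter> space M |B. B \<in> sets (\<Pi>\<^sub>M i\<in>{1..}. borel)} \<subseteq> M.events"
      using measurable_sets by blast
  next
    fix a b assume "a \<in> {fst -` A \<inter> space M |A. A \<in> sets (count_space UNIV)}"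
      "b \<in> {(\<lambda>\<omega>. \<lambda>i\<in>{1..}. snd \<omega> i) -` B \<inter> space M |B. B \<in> sets (\<Pi>\<^sub>M i\<in>{1..}. borel)}"
    then obtain A B where AB: "a = fst -` A" "b = (\<lambda>\<omega>. \<lambda>i\<in>{1..}. snd \<omega> i) -` B"
      "B \<in> sets (\<Pi>\<^sub>M i\<in>{1..}. borel)" by (auto simp: spM)
    \<comment> \<open>\<open>B\<close> concerns sequences indexed from 1. Its preimage under
      restriction is an event of the second factor, so \<open>a\<close> and \<open>b\<close> become
      the two sides of a rectangle.\<close>
    define C where "C = (\<lambda>y. \<lambda>i\<in>{1..}. y i) -` B \<inter> space (\<Pi>\<^sub>M i\<in>(UNIV::nat set). \<mu>)"
    have C: "C \<in> sets (\<Pi>\<^sub>M i\<in>UNIV. \<mu>)"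
      unfolding C_def by (rule measurable_sets[OF rm AB(3)])
    have "a = A \<times> UNIV" "b = UNIV \<times> C" "a \<inter> b = A \<times> C"
      by (auto simp: AB C_def spP)
    then show "M.prob (a \<inter> b) = M.prob a * M.prob b"
      using times[OF C] times[of UNIV A] prob_space.prob_space[OF PiM]
        sets.top[of "\<Pi>\<^sub>M i\<in>(UNIV::nat set). \<mu>"] by (simp add: spP)
  qed
  then show "max_model M fst (\<lambda>i \<omega>. snd \<omega> i)"
    using iv fst_meas M.prob_space_axioms distr_Y by (simp add: max_model_def iid_vectors_def)
  have "distr M (measure_pmf p) fst = measure_pmf p"
    unfolding M_def by (rule prob_space.distr_pair_fst[OF PiM])
  then have "measure_pmf.expectation p (\<lambda>n. s ^ n) = integral\<^sup>L (distr M (measure_pmf p) fst) (\<lambda>n. s ^ n)"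
    by simp
  also have "\<dots> = (\<integral>\<omega>. s ^ fst \<omega> \<partial>M)"
    by (rule integral_distr) (auto simp: M_def)
  finally show "(\<integral>\<omega>. s ^ fst \<omega> \<partial>M) = measure_pmf.expectation p (\<lambda>n. s ^ n)" ..
qed

section \<open>Products and powers of distribution functions\<close>

text \<open>The componentwise maximum of independent vectors has the product as its distribution
  function.\<close>

lemma is_dist_fun_mult:
  fixes F G :: "real ^ 'n \<Rightarrow> real"
  assumes "is_dist_fun F" "is_dist_fun G"
  shows "is_dist_fun (\<lambda>x. F x * G x)"
proof -
  obtain \<mu> \<nu> where \<mu>: "prob_space \<mu>" "sets \<mu> = sets borel" "F = dist_fun \<mu>"
    and \<nu>: "prob_space \<nu>" "sets \<nu> = sets borel" "G = dist_fun \<nu>"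
    using assms by (auto simp: is_dist_fun_def)
  interpret \<mu>: prob_space \<mu> by fact
  interpret \<nu>: prob_space \<nu> by fact
  interpret P: pair_prob_space \<mu> \<nu> ..
  define m :: "(real ^ 'n) \<times> (real ^ 'n) \<Rightarrow> real ^ 'n" where "m p = (\<chi> c. max (fst p $ c) (snd p $ c))" for p
  have "fst \<in> borel_measurable (\<mu> \<Otimes>\<^sub>M \<nu>)" "snd \<in> borel_measurable (\<mu> \<Otimes>\<^sub>M \<nu>)"
    using measurable_fst[of \<mu> \<nu>] measurable_snd[of \<mu> \<nu>]
    by (auto simp: measurable_cong_sets[OF refl \<mu>(2)] measurable_cong_sets[OF refl \<nu>(2)])
  then have m: "m \<in> borel_measurable (\<mu> \<Otimes>\<^sub>M \<nu>)"
    unfolding m_def by (intro borel_measurable_vec_lambda borel_measurable_max borel_measurable_vec_nth_comp)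
  have "F x * G x = dist_fun (distr (\<mu> \<Otimes>\<^sub>M \<nu>) borel m) x" for x
  proof -
    have "m -` {..x} \<inter> space (\<mu> \<Otimes>\<^sub>M \<nu>) = {..x} \<times> {..x}"
      using sets_eq_imp_space_eq[OF \<mu>(2)] sets_eq_imp_space_eq[OF \<nu>(2)]
      by (auto simp: m_def less_eq_vec_def space_pair_measure)
    then show ?thesis
      using m by (simp add: dist_fun_def measure_distr atMost_vec_borel \<mu>(2,3) \<nu>(2,3)
        measure_pair_Times[OF \<mu>(1) \<nu>(1)])
  qed
  with P.prob_space_distr[OF m] show ?thesis
    unfolding is_dist_fun_def by (intro exI[of _ "distr (\<mu> \<Otimes>\<^sub>M \<nu>) borel m"]) auto
qed

lemma is_dist_fun_power:
  assumes "is_dist_fun F" "m \<ge> 1"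
  shows "is_dist_fun (\<lambda>x. F x ^ m)"
  using assms(2)
proof (induction m rule: nat_induct_at_least)
  case (Suc m)
  then show ?case using is_dist_fun_mult[OF assms(1)] by simp
qed (simp add: assms(1))

section \<open>The function \<open>\<phi>(- log g)\<close>\<close>

text \<open>\<open>has_pgf\<close> speaks of \<open>0 < s < 1\<close>, but distribution functions
  also take the values 0 and 1. Both sides are continuous on \<open>{0..1}\<close>, so the identity
  extends to the endpoints.\<close>

lemma pgf_eq_closed_interval:
  fixes N :: "'a \<Rightarrow> nat"
  assumes "prob_space M" and N [measurable]: "N \<in> measurable M (count_space UNIV)"
    and P: "has_pgf M N P" "continuous_on {0..1} P" and s: "s \<in> {0..1}"
  shows "(\<integral>\<omega>. s ^ N \<omega> \<partial>M) = P s"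
proof -
  interpret prob_space M by fact
  have "continuous_on {0..1} (\<lambda>s::real. \<integral>\<omega>. s ^ N \<omega> \<partial>M)"
  proof (rule continuous_on_sequentiallyI)
    fix u :: "nat \<Rightarrow> real" and a assume u: "\<forall>n. u n \<in> {0..1}" "a \<in> {0..1}" "u \<longlonglongrightarrow> a"
    show "(\<lambda>n. \<integral>\<omega>. u n ^ N \<omega> \<partial>M) \<longlonglongrightarrow> (\<integral>\<omega>. a ^ N \<omega> \<partial>M)"
      using u by (intro integral_dominated_convergence[where w="\<lambda>_. 1"])
        (auto intro!: tendsto_power AE_I2 simp: power_le_one)
  qed
  then have "continuous_on (closure {0<..<1}) (\<lambda>s. (\<integral>\<omega>. s ^ N \<omega> \<partial>M) - P s)"
    using P(2) by (auto intro: continuous_intros)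
  moreover have "(\<integral>\<omega>. s ^ N \<omega> \<partial>M) - P s = 0" if "s \<in> {0<..<1}" for s
    using P(1) that by (simp add: has_pgf_def)
  ultimately have "(\<integral>\<omega>. s ^ N \<omega> \<partial>M) - P s = 0"
    by (rule continuous_constant_on_closure) (use s in auto)
  then show ?thesis by simp
qed

locale positive_variable = prob_space MZ for MZ :: "'z measure" +
  fixes Z :: "'z \<Rightarrow> real"
  assumes Z [measurable]: "Z \<in> borel_measurable MZ" and Z_pos: "AE \<omega> in MZ. 0 < Z \<omega>"
begin

text \<open>
  \<open>Phi g\<close> is \<open>\<phi>(- log g)\<close> including the convention at \<open>g = 0\<close>, because \<open>0 powr z = 0\<close>.
\<close>

definition Phi :: "real \<Rightarrow> real" where
  "Phi g = (\<integral>\<omega>. g powr Z \<omega> \<partial>MZ)"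

lemma laplace_transform_eq_Phi: "laplace_transform MZ Z v = Phi (exp (- v))"
  by (simp add: laplace_transform_def Phi_def powr_def mult.commute)

lemma at_ereal_neg_log_eq_Phi: "0 \<le> g \<Longrightarrow> at_ereal (laplace_transform MZ Z) (neg_log g) = Phi g"
  by (auto simp: at_ereal_def neg_log_def laplace_transform_eq_Phi) (simp add: Phi_def)

lemma Phi_0 [simp]: "Phi 0 = 0" and Phi_1 [simp]: "Phi 1 = 1"
  by (simp_all add: Phi_def prob_space)

lemma powr_Z_le_1: "g \<in> {0..1} \<Longrightarrow> AE \<omega> in MZ. norm (g powr Z \<omega>) \<le> 1"
  using Z_pos by eventually_elim (auto simp: powr_le1)

lemma integrable_powr_Z: "g \<in> {0..1} \<Longrightarrow> integrable MZ (\<lambda>\<omega>. g powr Z \<omega>)"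
  using powr_Z_le_1 by (intro integrable_const_bound[where B=1]) auto

lemma Phi_strict_mono: "strict_mono_on {0..1} Phi"
proof (rule strict_mono_onI)
  fix g h :: real assume gh: "g \<in> {0..1}" "h \<in> {0..1}" "g < h"
  have "AE \<omega> in MZ. g powr Z \<omega> < h powr Z \<omega>"
    using Z_pos by eventually_elim (use gh in \<open>auto intro: powr_less_mono2\<close>)
  then show "Phi g < Phi h"
    unfolding Phi_def using gh
    by (intro integral_less_AE_space integrable_powr_Z) (auto simp: emeasure_space_1)
qed

lemma Phi_mono: "g \<in> {0..1} \<Longrightarrow> h \<in> {0..1} \<Longrightarrow> g \<le> h \<Longrightarrow> Phi g \<le> Phi h"
  using strict_mono_on_leD[OF Phi_strict_mono] by blast

lemma Phi_bounds: "g \<in> {0..1} \<Longrightarrow> Phi g \<in> {0..1}"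
  using Phi_mono[of 0 g] Phi_mono[of g 1] by auto

lemma continuous_on_Phi: "continuous_on {0..1} Phi"
proof (rule continuous_on_sequentiallyI)
  fix u :: "nat \<Rightarrow> real" and a assume u: "\<forall>n. u n \<in> {0..1}" "a \<in> {0..1}" "u \<longlonglongrightarrow> a"
  show "(\<lambda>n. Phi (u n)) \<longlonglongrightarrow> Phi a"
    unfolding Phi_def
  proof (rule integral_dominated_convergence[where w="\<lambda>_. 1"])
    \<comment> \<open>Positivity of \<open>Z\<close> covers \<open>a = 0\<close>, where the power
      function is continuous from the right only for a positive exponent.\<close>
    show "AE \<omega> in MZ. (\<lambda>n. u n powr Z \<omega>) \<longlonglongrightarrow> a powr Z \<omega>"
      using Z_pos by eventually_elim (use u in \<open>auto intro!: tendsto_powr' always_eventually\<close>)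
  qed (use u powr_Z_le_1 in auto)
qed

text \<open>Recovers \<open>G\<close> from \<open>F = \<phi>(- log G)\<close>.\<close>

definition Psi :: "real \<Rightarrow> real" where "Psi = the_inv_into {0..1} Phi"

lemma Phi_inj: "inj_on Phi {0..1}"
  using Phi_strict_mono by (rule strict_mono_on_imp_inj_on)

lemma Phi_image: "Phi ` {0..1} = {0..1}"
proof
  show "{0..1} \<subseteq> Phi ` {0..1}"
  proof
    fix u :: real assume "u \<in> {0..1}"
    then show "u \<in> Phi ` {0..1}"
      using IVT'[of Phi 0 u 1] continuous_on_Phi by auto
  qed
qed (use Phi_bounds in auto)

lemma Psi_Phi: "g \<in> {0..1} \<Longrightarrow> Psi (Phi g) = g"
  unfolding Psi_def by (rule the_inv_into_f_f[OF Phi_inj])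

lemma Phi_Psi: "u \<in> {0..1} \<Longrightarrow> Phi (Psi u) = u"
  unfolding Psi_def using Phi_image by (intro f_the_inv_into_f[OF Phi_inj]) auto

lemma Psi_bounds: "u \<in> {0..1} \<Longrightarrow> Psi u \<in> {0..1}"
  unfolding Psi_def using the_inv_into_into[OF Phi_inj _ order_refl] Phi_image by blast

lemma Psi_0 [simp]: "Psi 0 = 0" and Psi_1 [simp]: "Psi 1 = 1"
  using Psi_Phi[of 0] Psi_Phi[of 1] by auto

lemma Psi_mono: "mono_on {0..1} Psi"
proof (rule mono_onI)
  fix u v :: real assume uv: "u \<in> {0..1}" "v \<in> {0..1}" "u \<le> v"
  show "Psi u \<le> Psi v"
  proof (rule ccontr)
    assume "\<not> Psi u \<le> Psi v"
    then have "Phi (Psi v) < Phi (Psi u)"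
      using uv Psi_bounds by (intro strict_mono_onD[OF Phi_strict_mono]) auto
    with uv show False by (simp add: Phi_Psi)
  qed
qed

lemma continuous_on_Psi: "continuous_on {0..1} Psi"
  using continuous_on_inv[OF continuous_on_Phi, of Psi] Psi_Phi Phi_image by auto

lemma phi_pgf_eq: "phi_pgf (laplace_transform MZ Z) j k \<theta> s = s ^ j * Phi (exp (- ((1 - s ^ k) / \<theta>)))"
  by (simp add: phi_pgf_def laplace_transform_eq_Phi)

lemma continuous_on_phi_pgf:
  "\<theta> > 0 \<Longrightarrow> continuous_on {0..1} (phi_pgf (laplace_transform MZ Z) j k \<theta>)"
  unfolding phi_pgf_eq
  by (intro continuous_intros continuous_on_compose2[OF continuous_on_Phi])
     (auto simp: power_le_one divide_nonneg_pos)

lemma Phi_exp_tendsto_0: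
  assumes "filterlim L at_top net"
  shows "((\<lambda>n. Phi (exp (- L n))) \<longlongrightarrow> 0) net"
proof -
  have "((\<lambda>n. exp (- L n)) \<longlongrightarrow> 0) net"
    using assms by (intro filterlim_compose[OF exp_at_bot]) (simp add: filterlim_uminus_at_bot)
  moreover have "\<forall>\<^sub>F n in net. exp (- L n) \<in> {0..1}"
    using assms by (auto simp: filterlim_at_top elim: allE[of _ 0] eventually_mono)
  ultimately show ?thesis
    using continuous_on_tendsto_compose[OF continuous_on_Phi, of "\<lambda>n. exp (- L n)" 0 net] by simp
qed

section \<open>Asymptotics as \<theta> tends to 0\<close>

text \<open>The sequence \<open>h\<close> stands for the values of the distribution functions at one
  point. The factor \<open>h n ^ j\<close> is asymptotically negligible, so
  \<open>g n = exp (- L n)\<close> tends to \<open>Psi u\<close>. Then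
  \<open>y n = 1 - \<theta> n * L n\<close>, raised to about \<open>1 / (r * \<theta> n)\<close>,
  behaves like \<open>exp (- L n / r)\<close>, that is, \<open>g n\<close> raised to
  \<open>1 / r\<close>.\<close>

lemma power_tendsto_of_phi_pgf_tendsto:
  fixes h \<theta> :: "nat \<Rightarrow> real"
  assumes h: "\<And>n. h n \<in> {0..1}" and \<theta>: "\<And>n. \<theta> n > 0" "\<theta> \<longlonglongrightarrow> 0"
    and k: "k \<ge> 1" and r: "r \<ge> (1::nat)" and u: "u \<in> {0..1}"
    and lim: "(\<lambda>n. phi_pgf (laplace_transform MZ Z) j k (\<theta> n) (h n)) \<longlonglongrightarrow> u"
  shows "(\<lambda>n. h n ^ (k * Suc (nat \<lfloor>1 / (real r * \<theta> n)\<rfloor>))) \<longlonglongrightarrow> Psi u powr (1 / real r)"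
proof -
  define y where "y n = h n ^ k" for n
  define L where "L n = (1 - y n) / \<theta> n" for n
  define g where "g n = exp (- L n)" for n
  \<comment> \<open>The \<open>Suc\<close> keeps the exponent positive, so that powers of
    distribution functions stay distribution functions, and puts \<open>\<theta> n * q n\<close>
    between \<open>1 / r\<close> and \<open>1 / r + \<theta> n\<close>.\<close>
  define q where "q n = Suc (nat \<lfloor>1 / (real r * \<theta> n)\<rfloor>)" for n
  have y: "0 \<le> y n" "y n \<le> 1" "y n \<le> h n" for n
    using h[of n] k power_decreasing[of 1 k "h n"] by (auto simp: y_def power_le_one)
  have L: "L n \<ge> 0" "\<theta> n * L n = 1 - y n" for n
    using y[of n] \<theta>(1)[of n] by (auto simp: L_def divide_nonneg_pos)
  have g: "g n \<in> {0..1}" for n using L by (simp add: g_def)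
  have sq: "(\<lambda>n. sqrt (\<theta> n)) \<longlonglongrightarrow> 0" using tendsto_real_sqrt[OF \<theta>(2)] by simp
  have sqi: "filterlim (\<lambda>n. 1 / sqrt (\<theta> n)) at_top sequentially"
    unfolding inverse_eq_divide[symmetric] using \<theta>(1)
    by (intro filterlim_inverse_at_top[OF sq]) simp
  \<comment> \<open>Either \<open>L n\<close> is large and \<open>Phi (g n)\<close> is small, or \<open>1 - h n ^ j \<le> j \<theta> n L n\<close> is small.\<close>
  have diff: "(\<lambda>n. Phi (g n) - h n ^ j * Phi (g n)) \<longlonglongrightarrow> 0"
  proof (rule tendsto_sandwich[where f="\<lambda>_. 0"])
    show "\<forall>\<^sub>F n in sequentially. 0 \<le> Phi (g n) - h n ^ j * Phi (g n)"
      using h Phi_bounds[OF g] by (auto simp: power_le_one mult_left_le_one_le)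
    show "\<forall>\<^sub>F n in sequentially. Phi (g n) - h n ^ j * Phi (g n)
        \<le> real j * sqrt (\<theta> n) + Phi (exp (- (1 / sqrt (\<theta> n))))"
    proof (intro always_eventually allI)
      fix n
      have P: "Phi (g n) \<in> {0..1}" by (rule Phi_bounds[OF g])
      have E: "exp (- (1 / sqrt (\<theta> n))) \<in> {0..1}" using \<theta>(1)[of n] by simp
      have hj: "0 \<le> h n ^ j" "h n ^ j \<le> 1" using h[of n] by (auto simp: power_le_one)
      show "Phi (g n) - h n ^ j * Phi (g n) \<le> real j * sqrt (\<theta> n) + Phi (exp (- (1 / sqrt (\<theta> n))))"
      \<comment> \<open>The threshold tends to infinity while its product with
        \<open>\<theta> n\<close> tends to 0, so the bound is small in both cases.\<close>
      proof (cases "L n \<ge> 1 / sqrt (\<theta> n)")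
        case True
        then have "Phi (g n) \<le> Phi (exp (- (1 / sqrt (\<theta> n))))"
          using g E by (intro Phi_mono) (auto simp: g_def)
        moreover have "0 \<le> h n ^ j * Phi (g n)" "0 \<le> real j * sqrt (\<theta> n)"
          using hj P \<theta>(1)[of n] by auto
        ultimately show ?thesis by linarith
      next
        case False
        have "1 - h n ^ j \<le> real j * (1 - h n)"
          using Bernoulli_inequality[of "h n - 1" j] h[of n] by (simp add: algebra_simps)
        also have "\<dots> \<le> real j * (\<theta> n * L n)"
          using y(3)[of n] L(2)[of n] by (intro mult_left_mono) auto
        also have "\<dots> \<le> real j * (\<theta> n * (1 / sqrt (\<theta> n)))"
          using False \<theta>(1)[of n] by (intro mult_left_mono) auto
        also have "\<theta> n * (1 / sqrt (\<theta> n)) = sqrt (\<theta> n)"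
          using \<theta>(1)[of n] by (simp add: real_div_sqrt)
        finally have "1 - h n ^ j \<le> real j * sqrt (\<theta> n)" .
        moreover have "(1 - h n ^ j) * Phi (g n) \<le> 1 - h n ^ j"
          using hj P by (intro mult_left_le) auto
        moreover have "Phi (g n) - h n ^ j * Phi (g n) = (1 - h n ^ j) * Phi (g n)"
          by (simp add: algebra_simps)
        moreover have "0 \<le> Phi (exp (- (1 / sqrt (\<theta> n))))" using Phi_bounds[OF E] by simp
        ultimately show ?thesis by linarith
      qed
    qed
    have "(\<lambda>n. real j * sqrt (\<theta> n) + Phi (exp (- (1 / sqrt (\<theta> n))))) \<longlonglongrightarrow> real j * 0 + 0"
      by (intro tendsto_intros sq Phi_exp_tendsto_0 sqi)
    then show "(\<lambda>n. real j * sqrt (\<theta> n) + Phi (exp (- (1 / sqrt (\<theta> n))))) \<longlonglongrightarrow> 0" by simp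
  qed auto
  have "(\<lambda>n. h n ^ j * Phi (g n)) \<longlonglongrightarrow> u"
    using lim by (simp add: phi_pgf_eq g_def L_def y_def)
  from tendsto_add[OF diff this] have "(\<lambda>n. Phi (g n)) \<longlonglongrightarrow> u" by simp
  then have "(\<lambda>n. Psi (Phi (g n))) \<longlonglongrightarrow> Psi u"
    using Phi_bounds[OF g] u by (intro continuous_on_tendsto_compose[OF continuous_on_Psi]) auto
  then have gl: "g \<longlonglongrightarrow> Psi u" by (simp only: Psi_Phi[OF g])
  have \<theta>q: "(\<lambda>n. \<theta> n * real (q n)) \<longlonglongrightarrow> 1 / real r"
  proof (rule tendsto_sandwich[where f="\<lambda>_. 1 / real r" and h="\<lambda>n. 1 / real r + \<theta> n"])
    have q: "1 / (real r * \<theta> n) \<le> real (q n)" "real (q n) \<le> 1 / (real r * \<theta> n) + 1" for n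
    proof -
      have "0 \<le> 1 / (real r * \<theta> n)" using \<theta>(1)[of n] by simp
      then have "real (q n) = of_int \<lfloor>1 / (real r * \<theta> n)\<rfloor> + 1" by (simp add: q_def)
      then show "1 / (real r * \<theta> n) \<le> real (q n)" "real (q n) \<le> 1 / (real r * \<theta> n) + 1" by linarith+
    qed
    have m: "\<theta> n * (1 / (real r * \<theta> n)) = 1 / real r" for n
      using \<theta>(1)[of n] by simp
    show "\<forall>\<^sub>F n in sequentially. 1 / real r \<le> \<theta> n * real (q n)"
    proof (intro always_eventually allI)
      fix n
      have "\<theta> n * (1 / (real r * \<theta> n)) \<le> \<theta> n * real (q n)"
        using q(1)[of n] \<theta>(1)[of n] by (intro mult_left_mono) auto
      then show "1 / real r \<le> \<theta> n * real (q n)" by (simp only: m)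
    qed
    show "\<forall>\<^sub>F n in sequentially. \<theta> n * real (q n) \<le> 1 / real r + \<theta> n"
    proof (intro always_eventually allI)
      fix n
      have "\<theta> n * real (q n) \<le> \<theta> n * (1 / (real r * \<theta> n) + 1)"
        using q(2)[of n] \<theta>(1)[of n] by (intro mult_left_mono) auto
      then show "\<theta> n * real (q n) \<le> 1 / real r + \<theta> n" using m[of n] by (simp only: distrib_left mult_1_right)
    qed
    have "(\<lambda>n. 1 / real r + \<theta> n) \<longlonglongrightarrow> 1 / real r + 0" by (intro tendsto_intros \<theta>(2))
    then show "(\<lambda>n. 1 / real r + \<theta> n) \<longlonglongrightarrow> 1 / real r" by simp
  qed auto
  have r0: "0 < 1 / real r" using r by simp
  have up: "(\<lambda>n. g n powr (\<theta> n * real (q n))) \<longlonglongrightarrow> Psi u powr (1 / real r)"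
    using r0 g by (intro tendsto_powr'[OF gl \<theta>q]) (auto intro!: always_eventually)
  have y_up: "y n ^ q n \<le> g n powr (\<theta> n * real (q n))" for n
  proof -
    have "y n \<le> exp (- (\<theta> n * L n))" using exp_ge_add_one_self[of "y n - 1"] by (simp add: L(2))
    then have "y n ^ q n \<le> exp (- (\<theta> n * L n)) ^ q n" using y by (intro power_mono)
    also have "\<dots> = g n powr (\<theta> n * real (q n))"
      by (simp add: g_def powr_def exp_of_nat_mult[symmetric] algebra_simps)
    finally show ?thesis .
  qed
  \<comment> \<open>For \<open>Psi u = 0\<close> the upper bound suffices. Otherwise
    \<open>L n\<close> converges, hence \<open>y n\<close> tends to 1, and a matching lower bound is
    available.\<close>
  have "(\<lambda>n. y n ^ q n) \<longlonglongrightarrow> Psi u powr (1 / real r)"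
  proof (cases "Psi u = 0")
    case True
    show ?thesis
      by (rule tendsto_sandwich[OF _ _ _ up, where f="\<lambda>_. 0"]) (use y_up y True in auto)
  next
    case False
    have "(\<lambda>n. \<theta> n * (- ln (g n))) \<longlonglongrightarrow> 0 * (- ln (Psi u))"
      by (intro tendsto_intros \<theta>(2) gl False)
    then have "(\<lambda>n. 1 - (1 - y n)) \<longlonglongrightarrow> 1 - 0"
      by (intro tendsto_diff tendsto_const) (simp add: g_def L(2))
    then have yl: "y \<longlonglongrightarrow> 1" by simp
    have y_pos: "\<forall>\<^sub>F n in sequentially. 0 < y n" using order_tendstoD(1)[OF yl, of 0] by simp
    show ?thesis
    proof (rule tendsto_sandwich[OF _ _ _ up])
      have "(\<lambda>n. \<theta> n * real (q n) / y n) \<longlonglongrightarrow> 1 / real r / 1"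
        by (intro tendsto_intros \<theta>q yl) simp
      then show "(\<lambda>n. g n powr (\<theta> n * real (q n) / y n)) \<longlonglongrightarrow> Psi u powr (1 / real r)"
        using False by (intro tendsto_powr gl) auto
      show "\<forall>\<^sub>F n in sequentially. g n powr (\<theta> n * real (q n) / y n) \<le> y n ^ q n"
        using y_pos
      proof eventually_elim
        case (elim n)
        \<comment> \<open>The inequality \<open>1 + x \<le> exp x\<close> at
          \<open>x = 1 / y n - 1\<close>; it bounds \<open>y n\<close> from below with an exponent
          that differs from the one in \<open>y_up\<close> only by the factor
          \<open>1 / y n\<close>.\<close>
        have "inverse (y n) \<le> exp (\<theta> n * L n / y n)"
          using exp_ge_add_one_self[of "1 / y n - 1"] elim
          by (simp add: L(2) diff_divide_distrib inverse_eq_divide)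
        then have "exp (- (\<theta> n * L n / y n)) \<le> y n"
          using elim by (simp add: exp_minus inverse_le_imp_le le_imp_inverse_le)
        then have "exp (- (\<theta> n * L n / y n)) ^ q n \<le> y n ^ q n" by (intro power_mono) auto
        then show ?case by (simp add: g_def powr_def exp_of_nat_mult[symmetric] algebra_simps)
      qed
    qed (use y_up in auto)
  qed
  then show ?thesis by (simp only: y_def q_def power_mult)
qed

text \<open>For \<open>g > 0\<close> the root \<open>h\<close> of order about
  \<open>k / \<theta>\<close> satisfies \<open>h ^ k = exp (k * ln g / n)\<close>, close to
  \<open>1 + \<theta> * ln g\<close>. So \<open>(1 - h ^ k) / \<theta>\<close> tends to
  \<open>- ln g\<close>, while \<open>h ^ j\<close> tends to 1.\<close>

lemma phi_pgf_root_tendsto: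
  assumes g: "g \<in> {0..1}" and k: "k \<ge> (1::nat)"
  shows "((\<lambda>\<theta>. phi_pgf (laplace_transform MZ Z) j k \<theta> (g powr (1 / real (nat \<lceil>real k / \<theta>\<rceil>))))
    \<longlongrightarrow> Phi g) (at_right 0)"
proof -
  define n where "n \<theta> = real (nat \<lceil>real k / \<theta>\<rceil>)" for \<theta>
  have pos: "\<forall>\<^sub>F \<theta> in at_right (0::real). 0 < \<theta>" by (rule eventually_at_right_less)
  have inv: "filterlim (\<lambda>\<theta>::real. 1 / \<theta>) at_top (at_right 0)"
    using filterlim_inverse_at_top_right by (simp add: inverse_eq_divide)
  show ?thesis
  proof (cases "g = 0")
    case True
    \<comment> \<open>All roots of 0 are 0. The value is 0 for \<open>j > 0\<close> and
      \<open>Phi (exp (- (1 / \<theta>)))\<close> for \<open>j = 0\<close>; the latter bounds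
      both.\<close>
    have "((\<lambda>\<theta>. phi_pgf (laplace_transform MZ Z) j k \<theta> 0) \<longlongrightarrow> 0) (at_right 0)"
    proof (rule tendsto_sandwich[OF _ _ tendsto_const Phi_exp_tendsto_0[OF inv]])
      have "Phi (exp (- (1 / \<theta>))) \<in> {0..1}" if "0 < \<theta>" for \<theta>
        using that by (intro Phi_bounds) auto
      then show "\<forall>\<^sub>F \<theta> in at_right 0. 0 \<le> phi_pgf (laplace_transform MZ Z) j k \<theta> 0"
        "\<forall>\<^sub>F \<theta> in at_right 0. phi_pgf (laplace_transform MZ Z) j k \<theta> 0 \<le> Phi (exp (- (1 / \<theta>)))"
        using pos k by (auto simp: phi_pgf_eq power_0_left elim!: eventually_mono)
    qed
    then show ?thesis using True by simp
  next
    case False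
    then have g0: "0 < g" "ln g \<le> 0" using g by auto
    have n: "real k \<le> n \<theta> * \<theta>" "n \<theta> * \<theta> \<le> real k + \<theta>" "0 < n \<theta>" if "0 < \<theta>" for \<theta>
    proof -
      have "0 < real k / \<theta>" using that k by simp
      then have b: "real k / \<theta> \<le> n \<theta>" "n \<theta> \<le> real k / \<theta> + 1" unfolding n_def by linarith+
      with \<open>0 < real k / \<theta>\<close> show "0 < n \<theta>" by linarith
      from b that show "real k \<le> n \<theta> * \<theta>" "n \<theta> * \<theta> \<le> real k + \<theta>"
        by (auto simp: field_simps)
    qed
    have id0: "((\<lambda>\<theta>::real. \<theta>) \<longlongrightarrow> 0) (at_right 0)" by (rule tendsto_ident_at)
    have n\<theta>: "((\<lambda>\<theta>. n \<theta> * \<theta>) \<longlongrightarrow> real k) (at_right 0)"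
    proof (rule tendsto_sandwich)
      show "\<forall>\<^sub>F \<theta> in at_right 0. real k \<le> n \<theta> * \<theta>" "\<forall>\<^sub>F \<theta> in at_right 0. n \<theta> * \<theta> \<le> real k + \<theta>"
        using pos n by (auto elim!: eventually_mono)
      show "((\<lambda>\<theta>. real k + \<theta>) \<longlongrightarrow> real k) (at_right 0)"
        using tendsto_add[OF tendsto_const id0, of "real k"] by simp
    qed auto
    define a where "a \<theta> = real k * ln g / n \<theta>" for \<theta>
    have "((\<lambda>\<theta>. real k * ln g / (n \<theta> * \<theta>)) \<longlongrightarrow> real k * ln g / real k) (at_right 0)"
      using k by (intro tendsto_intros n\<theta>) auto
    then have a\<theta>: "((\<lambda>\<theta>. a \<theta> / \<theta>) \<longlongrightarrow> ln g) (at_right 0)"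
      using k by (simp add: a_def)
    have "((\<lambda>\<theta>. a \<theta> / \<theta> * \<theta>) \<longlongrightarrow> ln g * 0) (at_right 0)"
      by (intro tendsto_mult a\<theta> id0)
    then have a0: "(a \<longlongrightarrow> 0) (at_right 0)"
      unfolding mult_zero_right
      by (rule Lim_transform_eventually) (rule eventually_mono[OF pos], simp)
    define h where "h \<theta> = g powr (1 / n \<theta>)" for \<theta>
    have h_eq: "h \<theta> = exp (a \<theta> / real k)" for \<theta>
      using g0 k by (simp add: h_def a_def powr_def)
    have hk: "h \<theta> ^ k = exp (a \<theta>)" for \<theta>
      using k by (simp add: h_eq exp_of_nat_mult[symmetric])
    have a_neg: "a \<theta> \<le> 0" if "0 < \<theta>" for \<theta>
      using g0 n(3)[OF that] by (simp add: a_def mult_nonneg_nonpos divide_nonpos_pos)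
    have h1: "((\<lambda>\<theta>. h \<theta> ^ j) \<longlongrightarrow> exp (0 / real k) ^ j) (at_right 0)"
      unfolding h_eq using k by (intro tendsto_intros a0) auto
    \<comment> \<open>For \<open>a \<le> 0\<close> one has
      \<open>- a / (1 - a) \<le> 1 - exp a \<le> - a\<close>; both bounds come from
      \<open>1 + x \<le> exp x\<close>.\<close>
    have "((\<lambda>\<theta>. (1 - h \<theta> ^ k) / \<theta>) \<longlongrightarrow> - ln g) (at_right 0)"
    proof (rule tendsto_sandwich[where f="\<lambda>\<theta>. - (a \<theta> / \<theta>) / (1 - a \<theta>)" and h="\<lambda>\<theta>. - (a \<theta> / \<theta>)"])
      show "((\<lambda>\<theta>. - (a \<theta> / \<theta>)) \<longlongrightarrow> - ln g) (at_right 0)" by (intro tendsto_intros a\<theta>)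
      have "((\<lambda>\<theta>. - (a \<theta> / \<theta>) / (1 - a \<theta>)) \<longlongrightarrow> - ln g / (1 - 0)) (at_right 0)"
        by (intro tendsto_intros a\<theta> a0) simp
      then show "((\<lambda>\<theta>. - (a \<theta> / \<theta>) / (1 - a \<theta>)) \<longlongrightarrow> - ln g) (at_right 0)" by simp
      show "\<forall>\<^sub>F \<theta> in at_right 0. (1 - h \<theta> ^ k) / \<theta> \<le> - (a \<theta> / \<theta>)"
        using pos
      proof eventually_elim
        case (elim \<theta>)
        have "1 - h \<theta> ^ k \<le> - a \<theta>" unfolding hk using exp_ge_add_one_self[of "a \<theta>"] by linarith
        then show ?case using elim divide_right_mono[of "1 - h \<theta> ^ k" "- a \<theta>" \<theta>] by simp
      qed
      show "\<forall>\<^sub>F \<theta> in at_right 0. - (a \<theta> / \<theta>) / (1 - a \<theta>) \<le> (1 - h \<theta> ^ k) / \<theta>"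
        using pos
      proof eventually_elim
        case (elim \<theta>)
        have a1: "0 < 1 - a \<theta>" using a_neg[OF elim] by simp
        have "exp (a \<theta>) * (1 - a \<theta>) \<le> exp (a \<theta>) * exp (- a \<theta>)"
          using exp_ge_add_one_self[of "- a \<theta>"] by (intro mult_left_mono) auto
        then have "exp (a \<theta>) * (1 - a \<theta>) \<le> 1" by (simp add: exp_minus)
        then have "- a \<theta> / (1 - a \<theta>) \<le> 1 - exp (a \<theta>)"
          using a1 by (simp add: field_simps)
        then have "- a \<theta> / (1 - a \<theta>) / \<theta> \<le> (1 - exp (a \<theta>)) / \<theta>"
          using elim by (intro divide_right_mono) auto
        then show ?case by (simp add: hk mult.commute)
      qed
    qed
    then have "((\<lambda>\<theta>. exp (- ((1 - h \<theta> ^ k) / \<theta>))) \<longlongrightarrow> exp (- (- ln g))) (at_right 0)"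
      by (intro tendsto_intros)
    then have "((\<lambda>\<theta>. exp (- ((1 - h \<theta> ^ k) / \<theta>))) \<longlongrightarrow> g) (at_right 0)"
      using g0 by simp
    moreover have "\<forall>\<^sub>F \<theta> in at_right 0. exp (- ((1 - h \<theta> ^ k) / \<theta>)) \<in> {0..1}"
      using pos a_neg by (auto simp: hk elim!: eventually_mono)
    ultimately have "((\<lambda>\<theta>. Phi (exp (- ((1 - h \<theta> ^ k) / \<theta>)))) \<longlongrightarrow> Phi g) (at_right 0)"
      using g by (intro continuous_on_tendsto_compose[OF continuous_on_Phi])
    from tendsto_mult[OF h1 this] show ?thesis
      by (simp add: phi_pgf_eq h_def n_def)
  qed
qed

section \<open>Max-infinite divisibility and the two directions\<close>

text \<open>For each \<open>r\<close> the root of order \<open>r\<close> is a limit of integer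
  powers of the distribution functions \<open>H n\<close>, so \<open>dist_fun_limit\<close> applies;
  \<open>r = 1\<close> gives \<open>Psi (F x)\<close> itself.\<close>

lemma MID_Psi:
  fixes F :: "real ^ 'n \<Rightarrow> real" and H :: "nat \<Rightarrow> real ^ 'n \<Rightarrow> real"
  assumes F: "is_dist_fun F" and H: "\<And>n. is_dist_fun (H n)"
    and \<theta>: "\<And>n. \<theta> n > 0" "\<theta> \<longlonglongrightarrow> 0" and k: "k \<ge> 1"
    and lim: "dist_fun_tendsto (\<lambda>n x. phi_pgf (laplace_transform MZ Z) j k (\<theta> n) (H n x)) F sequentially"
  shows "MID (\<lambda>x. Psi (F x))"
proof -
  have F01: "F x \<in> {0..1}" for x using is_dist_fun_bounds[OF F] by auto
  have root: "is_dist_fun (\<lambda>x. Psi (F x) powr (1 / real r))" if r: "r \<ge> 1" for r :: nat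
  proof (rule dist_fun_limit)
    show "df_like (\<lambda>x. Psi (F x) powr (1 / real r))"
    proof (rule df_like_compose[OF is_dist_fun_df_like[OF F] F01, where p="\<lambda>u. Psi u powr (1 / real r)"])
      show "mono_on {0..1} (\<lambda>u. Psi u powr (1 / real r))"
        using Psi_mono Psi_bounds by (auto simp: mono_on_def intro!: powr_mono2)
      show "continuous_on {0..1} (\<lambda>u. Psi u powr (1 / real r))"
        using r Psi_bounds by (intro continuous_on_powr' continuous_on_Psi continuous_intros) auto
    qed auto
    show "is_dist_fun (\<lambda>x. H n x ^ (k * Suc (nat \<lfloor>1 / (real r * \<theta> n)\<rfloor>)))" for n
      using k by (intro is_dist_fun_power[OF H]) auto
    show "dist_fun_tendsto (\<lambda>n x. H n x ^ (k * Suc (nat \<lfloor>1 / (real r * \<theta> n)\<rfloor>)))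
        (\<lambda>x. Psi (F x) powr (1 / real r)) sequentially"
      unfolding dist_fun_tendsto_def
    proof (intro allI impI)
      \<comment> \<open>The hypothesis \<open>lim\<close> speaks of continuity points of
        \<open>F\<close>, the goal of those of the root. Raising to the power \<open>r\<close> and
        applying \<open>Phi\<close> recovers \<open>F\<close>, so continuity passes from the root to
        \<open>F\<close>.\<close>
      fix x assume "isCont (\<lambda>x. Psi (F x) powr (1 / real r)) x"
      then have "isCont (\<lambda>x. (Psi (F x) powr (1 / real r)) powr real r) x"
        unfolding isCont_def using r
        by (rule_tac tendsto_powr'[OF _ tendsto_const]) (auto intro!: always_eventually simp del: powr_powr)
      moreover have "(Psi (F y) powr (1 / real r)) powr real r = Psi (F y)" for y
        using r Psi_bounds[OF F01[of y]] by (simp add: powr_powr)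
      ultimately have "((\<lambda>y. Psi (F y)) \<longlongrightarrow> Psi (F x)) (at x)"
        by (simp add: isCont_def)
      then have "((\<lambda>y. Phi (Psi (F y))) \<longlongrightarrow> Phi (Psi (F x))) (at x)"
        using Psi_bounds[OF F01]
        by (intro continuous_on_tendsto_compose[OF continuous_on_Phi]) auto
      then have "isCont F x" by (simp add: isCont_def Phi_Psi[OF F01])
      then have "(\<lambda>n. phi_pgf (laplace_transform MZ Z) j k (\<theta> n) (H n x)) \<longlonglongrightarrow> F x"
        using lim by (simp add: dist_fun_tendsto_def)
      then show "(\<lambda>n. H n x ^ (k * Suc (nat \<lfloor>1 / (real r * \<theta> n)\<rfloor>))) \<longlonglongrightarrow> Psi (F x) powr (1 / real r)"
        using is_dist_fun_bounds[OF H]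
        by (intro power_tendsto_of_phi_pgf_tendsto[OF _ \<theta> k r F01]) auto
    qed
  qed
  have "(\<lambda>x. Psi (F x) powr (1 / real 1)) = (\<lambda>x. Psi (F x))"
    using Psi_bounds[OF F01] by simp
  then show ?thesis
    unfolding MID_def using root[of 1] root by simp
qed

text \<open>The witnesses are the generating functions of the class, the distribution functions of
  \<open>Y \<theta> 1\<close>, the given sequence, and \<open>Psi (F x)\<close> for
  \<open>G\<close>.\<close>

lemma limit_law_phi_MID:
  fixes F :: "real ^ 'n \<Rightarrow> real" and Y :: "real \<Rightarrow> nat \<Rightarrow> 'a \<Rightarrow> real ^ 'n"
  assumes \<Theta>: "\<Theta> \<subseteq> {0<..}" and k: "k \<ge> 1"
    and model: "\<And>\<theta>. \<theta> \<in> \<Theta> \<Longrightarrow> max_model (M \<theta>) (N \<theta>) (Y \<theta>)"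
    and pgf: "\<And>\<theta>. \<theta> \<in> \<Theta> \<Longrightarrow> has_pgf (M \<theta>) (N \<theta>) (phi_pgf (laplace_transform MZ Z) j k \<theta>)"
    and \<theta>s: "decreases_to_0 \<Theta> \<theta>s" and F: "is_dist_fun F"
    and lim: "dist_fun_tendsto (\<lambda>n. ext_dist_fun (M (\<theta>s n)) (rand_max (N (\<theta>s n)) (Y (\<theta>s n)))) F sequentially"
  shows "phi_MID \<Theta> (laplace_transform MZ Z) F"
proof -
  let ?P = "phi_pgf (laplace_transform MZ Z) j k"
  define H where "H \<theta> = dist_fun (distr (M \<theta>) borel (Y \<theta> 1))" for \<theta>
  have H: "is_dist_fun (H \<theta>)" if "\<theta> \<in> \<Theta>" for \<theta>
  proof -
    interpret M: prob_space "M \<theta>" using model[OF that] by (simp add: max_model_def)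
    have "M.indep_vars (\<lambda>_. borel) (Y \<theta>) {1..}"
      using model[OF that] by (simp add: max_model_def iid_vectors_def)
    then have "Y \<theta> 1 \<in> borel_measurable (M \<theta>)" by (auto simp: M.indep_vars_def2)
    then show ?thesis
      unfolding is_dist_fun_def H_def by (intro exI[of _ "distr (M \<theta>) borel (Y \<theta> 1)"])
        (auto intro: M.prob_space_distr)
  qed
  have ext: "ext_dist_fun (M \<theta>) (rand_max (N \<theta>) (Y \<theta>)) x = ?P \<theta> (H \<theta> x)" if "\<theta> \<in> \<Theta>" for \<theta> x
    using model[OF that] is_dist_fun_bounds[OF H[OF that]] \<Theta> that
    unfolding max_model_ext_dist_fun[OF model[OF that]] H_def
    by (intro pgf_eq_closed_interval[OF _ _ pgf[OF that]] continuous_on_phi_pgf)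
       (auto simp: max_model_def)
  have in\<Theta>: "\<theta>s n \<in> \<Theta>" for n using \<theta>s by (auto simp: decreases_to_0_def)
  have lim': "dist_fun_tendsto (\<lambda>n x. ?P (\<theta>s n) (H (\<theta>s n) x)) F sequentially"
    using lim by (simp add: dist_fun_tendsto_def ext[OF in\<Theta>])
  have "is_pgf (?P \<theta>)" if "\<theta> \<in> \<Theta>" for \<theta>
    using phi_pgf_pmf[OF prob_space_axioms Z Z_pos, of \<theta> j k] \<Theta> that
    unfolding is_pgf_def by (metis greaterThan_iff subsetD)
  moreover have "MID (\<lambda>x. Psi (F x))"
    using H in\<Theta> \<Theta> \<theta>s by (intro MID_Psi[OF F _ _ _ k lim']) (auto simp: decreases_to_0_def)
  moreover have "F = (\<lambda>x. at_ereal (laplace_transform MZ Z) (neg_log (Psi (F x))))"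
  proof
    fix x
    have "F x \<in> {0..1}" using is_dist_fun_bounds[OF F] by simp
    then show "F x = at_ereal (laplace_transform MZ Z) (neg_log (Psi (F x)))"
      using Psi_bounds[of "F x"] by (simp add: at_ereal_neg_log_eq_Phi Phi_Psi)
  qed
  ultimately show ?thesis
    unfolding phi_MID_def using F H \<theta>s lim'
    by (intro conjI exI[of _ H] exI[of _ ?P] exI[of _ \<theta>s] exI[of _ "\<lambda>x. Psi (F x)"]) auto
qed

lemma phi_MID_is_limit_law:
  fixes G :: "real ^ 'n \<Rightarrow> real"
  assumes \<Theta>: "\<Theta> \<subseteq> {0<..}" and k: "k \<ge> 1" and G: "MID G"
  shows "\<exists>(M :: real \<Rightarrow> (nat \<times> (nat \<Rightarrow> real ^ 'n)) measure) N Y.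
    (\<forall>\<theta>\<in>\<Theta>. max_model (M \<theta>) (N \<theta>) (Y \<theta>) \<and>
       has_pgf (M \<theta>) (N \<theta>) (phi_pgf (laplace_transform MZ Z) j k \<theta>)) \<and>
    dist_fun_tendsto (\<lambda>\<theta>. ext_dist_fun (M \<theta>) (rand_max (N \<theta>) (Y \<theta>)))
      (\<lambda>x. at_ereal (laplace_transform MZ Z) (neg_log (G x))) (at 0 within \<Theta>)"
proof -
  let ?P = "phi_pgf (laplace_transform MZ Z) j k"
  \<comment> \<open>The order of the root is at least 1 because \<open>k / \<theta>\<close> is
    positive, so \<open>MID G\<close> makes \<open>H \<theta>\<close> a distribution
    function.\<close>
  define H where "H \<theta> x = G x powr (1 / real (nat \<lceil>real k / \<theta>\<rceil>))" for \<theta> x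
  have "\<exists>\<mu>. prob_space \<mu> \<and> sets \<mu> = sets borel \<and> H \<theta> = dist_fun \<mu>" if "\<theta> \<in> \<Theta>" for \<theta>
  proof -
    have "0 < real k / \<theta>" using that \<Theta> k by auto
    then have "nat \<lceil>real k / \<theta>\<rceil> \<ge> 1" by linarith
    then show ?thesis using G unfolding MID_def H_def is_dist_fun_def by blast
  qed
  then obtain \<mu> where \<mu>: "\<And>\<theta>. \<theta> \<in> \<Theta> \<Longrightarrow> prob_space (\<mu> \<theta>)" "\<And>\<theta>. \<theta> \<in> \<Theta> \<Longrightarrow> sets (\<mu> \<theta>) = sets borel"
    "\<And>\<theta>. \<theta> \<in> \<Theta> \<Longrightarrow> H \<theta> = dist_fun (\<mu> \<theta>)" by metis
  have "\<exists>p :: nat pmf. \<forall>s\<in>{0..1}. measure_pmf.expectation p (\<lambda>n. s ^ n) = ?P \<theta> s" if "\<theta> \<in> \<Theta>" for \<theta>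
    using \<Theta> that by (intro phi_pgf_pmf[OF prob_space_axioms Z Z_pos]) auto
  then obtain p :: "real \<Rightarrow> nat pmf" where p: "\<And>\<theta> s. \<theta> \<in> \<Theta> \<Longrightarrow> s \<in> {0..1} \<Longrightarrow>
      measure_pmf.expectation (p \<theta>) (\<lambda>n. s ^ n) = ?P \<theta> s" by metis
  define M where "M \<theta> = measure_pmf (p \<theta>) \<Otimes>\<^sub>M (\<Pi>\<^sub>M i\<in>(UNIV::nat set). \<mu> \<theta>)" for \<theta>
  have model: "max_model (M \<theta>) fst (\<lambda>i \<omega>. snd \<omega> i)"
    and law: "distr (M \<theta>) borel (\<lambda>\<omega>. snd \<omega> 1) = \<mu> \<theta>"
    and pgf: "(\<integral>\<omega>. s ^ fst \<omega> \<partial>M \<theta>) = measure_pmf.expectation (p \<theta>) (\<lambda>n. s ^ n)"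
    if "\<theta> \<in> \<Theta>" for \<theta> and s :: real
    unfolding M_def by (rule max_model_exists[OF \<mu>(1)[OF that] \<mu>(2)[OF that]])+
  have ext: "ext_dist_fun (M \<theta>) (rand_max fst (\<lambda>i \<omega>. snd \<omega> i)) x = ?P \<theta> (H \<theta> x)" if "\<theta> \<in> \<Theta>" for \<theta> x
  proof -
    have "H \<theta> x \<in> {0..1}"
      using \<mu>[OF that] by (simp add: dist_fun_def prob_space.prob_le_1)
    then show ?thesis
      unfolding max_model_ext_dist_fun[OF model[OF that]] law[OF that] \<mu>(3)[OF that, symmetric]
      using p[OF that] by (simp add: pgf[OF that])
  qed
  \<comment> \<open>Convergence holds at every \<open>x\<close>. As \<Theta> lies in the positive
    half-line, \<open>at 0 within \<Theta>\<close> refines \<open>at_right 0\<close>, where the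
    limit is known.\<close>
  have "((\<lambda>\<theta>. ext_dist_fun (M \<theta>) (rand_max fst (\<lambda>i \<omega>. snd \<omega> i)) x)
      \<longlongrightarrow> at_ereal (laplace_transform MZ Z) (neg_log (G x))) (at 0 within \<Theta>)" for x
  proof -
    have G01: "G x \<in> {0..1}" using G is_dist_fun_bounds[of G x] by (simp add: MID_def)
    have "((\<lambda>\<theta>. ?P \<theta> (H \<theta> x)) \<longlongrightarrow> Phi (G x)) (at 0 within \<Theta>)"
      using phi_pgf_root_tendsto[OF G01 k, of j] tendsto_mono[OF at_le[OF \<Theta>]] by (simp add: H_def)
    moreover have "\<forall>\<^sub>F \<theta> in at 0 within \<Theta>.
        ?P \<theta> (H \<theta> x) = ext_dist_fun (M \<theta>) (rand_max fst (\<lambda>i \<omega>. snd \<omega> i)) x"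
      by (auto simp: eventually_at_filter ext)
    ultimately have "((\<lambda>\<theta>. ext_dist_fun (M \<theta>) (rand_max fst (\<lambda>i \<omega>. snd \<omega> i)) x)
        \<longlongrightarrow> Phi (G x)) (at 0 within \<Theta>)"
      by (rule Lim_transform_eventually)
    then show ?thesis using G01 by (simp add: at_ereal_neg_log_eq_Phi)
  qed
  moreover have "has_pgf (M \<theta>) fst (?P \<theta>)" if "\<theta> \<in> \<Theta>" for \<theta>
    unfolding has_pgf_def using pgf[OF that] p[OF that] by simp
  ultimately show ?thesis
    using model
    by (intro exI[of _ M] exI[of _ "\<lambda>_. fst"] exI[of _ "\<lambda>_ i \<omega>. snd \<omega> i"])
       (auto simp: dist_fun_tendsto_def)
qed

end

text \<open>In the second half the probability spaces have the concrete type of pairs of a count and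
  a sequence, since a formula of HOL cannot quantify over types.\<close>

theorem theorem3p6:
  fixes \<Theta> :: "real set"
    and MZ :: "'z measure" and Z :: "'z \<Rightarrow> real" and \<phi> :: "real \<Rightarrow> real"
  assumes dim: "CARD('n::finite) \<ge> 2"
    and Theta_pos: "\<Theta> \<subseteq> {0<..}"
    and Theta_limpt: "0 islimpt \<Theta>"
    and MZ: "prob_space MZ"
    and Z_meas: "Z \<in> borel_measurable MZ"
    and Z_pos: "AE \<omega> in MZ. 0 < Z \<omega>"
    and phi: "\<phi> = laplace_transform MZ Z"
  shows "(\<forall>(M :: real \<Rightarrow> 'a measure) N (Y :: real \<Rightarrow> nat \<Rightarrow> 'a \<Rightarrow> real ^ 'n) (j::nat) (k::nat)
            (\<theta>s :: nat \<Rightarrow> real) (ks :: nat \<Rightarrow> nat) (MV :: 'v measure) (V :: 'v \<Rightarrow> real ^ 'n)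
            (F :: real ^ 'n \<Rightarrow> real).
            k \<ge> 1 \<longrightarrow>
            (\<forall>\<theta>\<in>\<Theta>. max_model (M \<theta>) (N \<theta>) (Y \<theta>) \<and>
                     has_pgf (M \<theta>) (N \<theta>) (phi_pgf \<phi> j k \<theta>)) \<longrightarrow>
            decreases_to_0 \<Theta> \<theta>s \<longrightarrow>
            prob_space MV \<longrightarrow> V \<in> borel_measurable MV \<longrightarrow>
            MID (dist_fun (distr MV borel V)) \<longrightarrow>
            dist_fun_tendsto
              (\<lambda>n. ext_dist_fun (M (\<theta>s n)) (rand_max (\<lambda>_. ks n) (Y (\<theta>s n))))
              (dist_fun (distr MV borel V)) sequentially \<longrightarrow>
            is_dist_fun F \<longrightarrow>
            dist_fun_tendsto
              (\<lambda>n. ext_dist_fun (M (\<theta>s n)) (rand_max (N (\<theta>s n)) (Y (\<theta>s n))))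
              F sequentially \<longrightarrow>
            phi_MID \<Theta> \<phi> F)
       \<and> (\<forall>F :: real ^ 'n \<Rightarrow> real. phi_MID \<Theta> \<phi> F \<longrightarrow>
            (\<forall>(j::nat) (k::nat). k \<ge> 1 \<longrightarrow>
              (\<exists>(M :: real \<Rightarrow> (nat \<times> (nat \<Rightarrow> real ^ 'n)) measure) N Y.
                (\<forall>\<theta>\<in>\<Theta>. max_model (M \<theta>) (N \<theta>) (Y \<theta>) \<and>
                         has_pgf (M \<theta>) (N \<theta>) (phi_pgf \<phi> j k \<theta>)) \<and>
                dist_fun_tendsto
                  (\<lambda>\<theta>. ext_dist_fun (M \<theta>) (rand_max (N \<theta>) (Y \<theta>)))
                  F (at 0 within \<Theta>))))"
proof (intro conjI allI impI)
  interpret positive_variable MZ Z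
    using MZ Z_meas Z_pos by (simp add: positive_variable_def positive_variable_axioms_def)
  show "phi_MID \<Theta> \<phi> F"
    if "k \<ge> 1" "\<forall>\<theta>\<in>\<Theta>. max_model (M \<theta>) (N \<theta>) (Y \<theta>) \<and> has_pgf (M \<theta>) (N \<theta>) (phi_pgf \<phi> j k \<theta>)"
      "decreases_to_0 \<Theta> \<theta>s" "is_dist_fun F"
      "dist_fun_tendsto (\<lambda>n. ext_dist_fun (M (\<theta>s n)) (rand_max (N (\<theta>s n)) (Y (\<theta>s n)))) F sequentially"
    for M :: "real \<Rightarrow> 'a measure" and N and Y :: "real \<Rightarrow> nat \<Rightarrow> 'a \<Rightarrow> real ^ 'n" and j k \<theta>s F
    using that unfolding phi by (intro limit_law_phi_MID[OF Theta_pos that(1)]) auto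
  show "\<exists>(M :: real \<Rightarrow> (nat \<times> (nat \<Rightarrow> real ^ 'n)) measure) N Y.
      (\<forall>\<theta>\<in>\<Theta>. max_model (M \<theta>) (N \<theta>) (Y \<theta>) \<and> has_pgf (M \<theta>) (N \<theta>) (phi_pgf \<phi> j k \<theta>)) \<and>
      dist_fun_tendsto (\<lambda>\<theta>. ext_dist_fun (M \<theta>) (rand_max (N \<theta>) (Y \<theta>))) F (at 0 within \<Theta>)"
    if F: "phi_MID \<Theta> \<phi> F" and "k \<ge> 1" for F :: "real ^ 'n \<Rightarrow> real" and j k
  proof -
    obtain G where "MID G" "F = (\<lambda>x. at_ereal \<phi> (neg_log (G x)))"
      using F unfolding phi_MID_def by blast
    then show ?thesis
      using phi_MID_is_limit_law[OF Theta_pos \<open>k \<ge> 1\<close>, of G j] by (simp only: phi)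
  qed
qed

end
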